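(* Let $f\colon X\to Y$ be a continuous map, $x_0\in X$ a base-point, and let $\tilde f_0\colon\tilde X\to\tilde Y$ be a fixed lifting of $f$ with respect to the universal covering maps $p\colon\tilde X\to X$ and $q\colon\tilde Y\to Y$. Then the canonical isomorphism $\pi_1(Y,f(x_0))\xrightarrow{\approx}\mathcal D(Y)$ restricts to an isomorphism $G^f(Y,f(x_0))\xrightarrow{\approx}\mathcal D^{\tilde f_0}(Y)$; that is, it maps the subgroup $G^f(Y,f(x_0))$ isomorphically onto $\mathcal D^{\tilde f_0}(Y)$.
   Context: All spaces are path-connected and have the homotopy type of a CW-complex; $X$ and $Y$ have universal coverings $p\colon\tilde X\to X$, $q\colon\tilde Y\to Y$, to which standard covering space theory applies (lifting criterion, unique lifting, the deck group acts simply transitively on each fibre). $I=[0,1]$. All maps are continuous. $\mathcal D(Y)$ is the group (under composition) of deck transformations of $q\colon\tilde Y\to Y$. A lifting of $f$ is a map $\tilde f\colon\tilde X\to\tilde Y$ with $q\tilde f=fp$. Canonical isomorphism: fix $\tilde x_0\in p^{-1}(x_0)$ and put $\tilde y_0=\tilde f_0(\tilde x_0)\in q^{-1}(f(x_0))$. The class of a loop $\alpha$ at $f(x_0)$ is sent to the unique $h\in\mathcal D(Y)$ such that $h(\tilde y_0)$ is the endpoint of the lift of $\alpha$ to $\tilde Y$ starting at $\tilde y_0$. Generalized Gottlieb group: $G^f(Y,f(x_0))$ is the subgroup of $\pi_1(Y,f(x_0))$ of all elements which can be represented by a map $\alpha\colon\mathbb S^1\to Y$ such that $f\vee\alpha\colon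 X\vee\mathbb S^1\to Y$ extends (up to homotopy) to a map $F\colon X\times\mathbb S^1\to Y$. Equivalently, it consists of the classes of loops $H(x_0,-)$, where $H\colon X\times I\to Y$ is a homotopy with $H(-,0)=H(-,1)=f$. Fibre-preserving homotopy: a map $\tilde H\colon\tilde X\times I\to\tilde Y$ is a fibre-preserving homotopy with respect to $p,q$ if, for all $\tilde x,\tilde x'\in\tilde X$ and $t\in I$, $p(\tilde x)=p(\tilde x')$ implies $q\tilde H(\tilde x,t)=q\tilde H(\tilde x',t)$. $\mathcal D^{\tilde f_0}(Y)$ is the set (it is a subgroup of $\mathcal D(Y)$) of all $h\in\mathcal D(Y)$ for which there is a fibre-preserving homotopy $\tilde H\colon\tilde X\times I\to\tilde Y$ with $\tilde H(-,0)=\tilde f_0$ and $\tilde H(-,1)=h\tilde f_0$. *)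

theory Defs
  imports "HOL-Analysis.Analysis" "HOL-Algebra.Bij"
begin

text \<open>
  A space is a subset of a type of class \<^class>\<open>topological_space\<close> with the subspace topology.
  Maps are functions on the ambient types, of which only the values on the carrier matter.
\<close>

text \<open>
  Whitehead's definition: a Hausdorff space partitioned into open cells \<open>e \<in> C\<close> of dimension
  \<open>d e\<close> with characteristic maps \<open>\<Phi> e\<close>, closure-finite and carrying the weak topology. For
  \<open>n = 0\<close> the ball is the one-point space and the sphere is empty.
\<close>

definition unit_cball :: "nat \<Rightarrow> (nat \<Rightarrow> real) set" where
  "unit_cball n = {x \<in> topspace (Euclidean_space n). (\<Sum>i<n. (x i)\<^sup>2) \<le> 1}"

definition unit_ball :: "nat \<Rightarrow> (nat \<Rightarrow> real) set" where
  "unit_ball n = {x \<in> topspace (Euclidean_space n). (\<Sum>i<n. (x i)\<^sup>2) < 1}"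

definition unit_sphere :: "nat \<Rightarrow> (nat \<Rightarrow> real) set" where
  "unit_sphere n = {x \<in> topspace (Euclidean_space n). (\<Sum>i<n. (x i)\<^sup>2) = 1}"

definition CW_structure ::
  "'a topology \<Rightarrow> 'a set set \<Rightarrow> ('a set \<Rightarrow> nat) \<Rightarrow> ('a set \<Rightarrow> (nat \<Rightarrow> real) \<Rightarrow> 'a) \<Rightarrow> bool" where
  "CW_structure K C d \<Phi> \<longleftrightarrow>
     \<Union>C = topspace K \<and> pairwise disjnt C \<and>
     (\<forall>e\<in>C.
        continuous_map (subtopology (Euclidean_space (d e)) (unit_cball (d e))) K (\<Phi> e) \<and>
        homeomorphic_map (subtopology (Euclidean_space (d e)) (unit_ball (d e)))
          (subtopology K e) (\<Phi> e) \<and>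
        (\<exists>B\<subseteq>C. finite B \<and> (\<forall>b\<in>B. d b < d e) \<and> \<Phi> e ` unit_sphere (d e) \<subseteq> \<Union>B)) \<and>
     (\<forall>A\<subseteq>topspace K. (\<forall>e\<in>C. closedin K (A \<inter> K closure_of e)) \<longrightarrow> closedin K A)"

definition CW_complex :: "'a topology \<Rightarrow> bool" where
  "CW_complex K \<longleftrightarrow> Hausdorff_space K \<and> (\<exists>C d \<Phi>. CW_structure K C d \<Phi>)"

definition loops :: "'a::topological_space set \<Rightarrow> 'a \<Rightarrow> (real \<Rightarrow> 'a) set" where
  "loops Y y = {\<alpha>. path \<alpha> \<and> path_image \<alpha> \<subseteq> Y \<and> pathstart \<alpha> = y \<and> pathfinish \<alpha> = y}"

definition loop_class :: "'a::topological_space set \<Rightarrow> (real \<Rightarrow> 'a) \<Rightarrow> (real \<Rightarrow> 'a) set" where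
  "loop_class Y \<alpha> = {\<beta>. homotopic_paths Y \<alpha> \<beta>}"

definition fundamental_group ::
  "'a::topological_space set \<Rightarrow> 'a \<Rightarrow> (real \<Rightarrow> 'a) set monoid" where
  "fundamental_group Y y =
     \<lparr>carrier = loop_class Y ` loops Y y,
      mult = (\<lambda>a b. \<Union>\<alpha>\<in>a. \<Union>\<beta>\<in>b. loop_class Y (\<alpha> +++ \<beta>)),
      one = loop_class Y (\<lambda>_. y)\<rparr>"

text \<open>Deck transformations are made extensional, as in \<^const>\<open>Bij\<close>, so that they are determined
  by their values on the total space.\<close>

definition deck_transformations ::
  "'e::topological_space set \<Rightarrow> ('e \<Rightarrow> 'b) \<Rightarrow> ('e \<Rightarrow> 'e) set" where
  "deck_transformations E q =
     {h \<in> extensional E. (\<exists>k. homeomorphism E E h k) \<and> (\<forall>e\<in>E. q (h e) = q e)}"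

definition deck_group :: "'e::topological_space set \<Rightarrow> ('e \<Rightarrow> 'b) \<Rightarrow> ('e \<Rightarrow> 'e) monoid" where
  "deck_group E q = (BijGroup E)\<lparr>carrier := deck_transformations E q\<rparr>"

text \<open>
  Spaces are not required to be locally path-connected. The part of standard covering space theory
  that does not hold for every simply connected covering, namely that the deck group acts simply
  transitively on each fibre, is therefore part of the definition.
\<close>

definition universal_covering ::
  "'e::topological_space set \<Rightarrow> ('e \<Rightarrow> 'b::topological_space) \<Rightarrow> 'b set \<Rightarrow> bool" where
  "universal_covering E q B \<longleftrightarrow>
     covering_space E q B \<and> simply_connected E \<and>
     (\<forall>e\<in>E. \<forall>e'\<in>E. q e = q e' \<longrightarrow> (\<exists>!h. h \<in> deck_transformations E q \<and> h e = e'))"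

definition lifting_of ::
  "'d::topological_space set \<Rightarrow> ('d \<Rightarrow> 'x) \<Rightarrow> 'e::topological_space set \<Rightarrow> ('e \<Rightarrow> 'y) \<Rightarrow>
   ('x \<Rightarrow> 'y) \<Rightarrow> ('d \<Rightarrow> 'e) \<Rightarrow> bool" where
  "lifting_of D p E q f g \<longleftrightarrow>
     continuous_on D g \<and> g \<in> D \<rightarrow> E \<and> (\<forall>x\<in>D. q (g x) = f (p x))"

definition path_lift ::
  "'e::topological_space set \<Rightarrow> ('e \<Rightarrow> 'y) \<Rightarrow> 'e \<Rightarrow> (real \<Rightarrow> 'y) \<Rightarrow> (real \<Rightarrow> 'e) \<Rightarrow> bool" where
  "path_lift E q e \<alpha> \<gamma> \<longleftrightarrow>
     path \<gamma> \<and> path_image \<gamma> \<subseteq> E \<and> pathstart \<gamma> = e \<and> (\<forall>t\<in>{0..1}. q (\<gamma> t) = \<alpha> t)"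

definition canonical_map ::
  "'e::topological_space set \<Rightarrow> ('e \<Rightarrow> 'y) \<Rightarrow> 'e \<Rightarrow> (real \<Rightarrow> 'y) set \<Rightarrow> ('e \<Rightarrow> 'e)" where
  "canonical_map E q e c =
     (THE h. h \<in> deck_transformations E q \<and>
             (\<exists>\<alpha>\<in>c. \<exists>\<gamma>. path_lift E q e \<alpha> \<gamma> \<and> h e = pathfinish \<gamma>))"

text \<open>
  The circle is the unit circle in \<^typ>\<open>complex\<close> with base point \<open>1\<close>, and the wedge of \<open>X\<close> with
  the circle is the subspace \<open>X \<times> {1} \<union> {x\<^sub>0} \<times> S\<^sup>1\<close> of the product.
\<close>

definition wedge_circle :: "'x set \<Rightarrow> 'x \<Rightarrow> ('x \<times> complex) set" where
  "wedge_circle X x0 = X \<times> {1} \<union> {x0} \<times> sphere 0 1"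

definition wedge_map :: "('x \<Rightarrow> 'y) \<Rightarrow> (complex \<Rightarrow> 'y) \<Rightarrow> 'x \<times> complex \<Rightarrow> 'y" where
  "wedge_map f a = (\<lambda>(x, z). if z = 1 then f x else a z)"

definition gottlieb_group ::
  "'x::topological_space set \<Rightarrow> 'y::topological_space set \<Rightarrow> ('x \<Rightarrow> 'y) \<Rightarrow> 'x \<Rightarrow>
   (real \<Rightarrow> 'y) set set" where
  "gottlieb_group X Y f x0 =
     {c \<in> carrier (fundamental_group Y (f x0)).
        \<exists>a. continuous_on (sphere 0 1) a \<and> a \<in> sphere 0 1 \<rightarrow> Y \<and> a 1 = f x0 \<and>
            c = loop_class Y (\<lambda>t. a (cis (2 * pi * t))) \<and>
            (\<exists>F. continuous_on (X \<times> sphere 0 1) F \<and> F \<in> X \<times> sphere 0 1 \<rightarrow> Y \<and>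
                 homotopic_with_canon (\<lambda>_. True) (wedge_circle X x0) Y F (wedge_map f a))}"

definition fibre_preserving_homotopy ::
  "'d::topological_space set \<Rightarrow> ('d \<Rightarrow> 'x) \<Rightarrow> 'e::topological_space set \<Rightarrow> ('e \<Rightarrow> 'y) \<Rightarrow>
   ('d \<times> real \<Rightarrow> 'e) \<Rightarrow> bool" where
  "fibre_preserving_homotopy D p E q H \<longleftrightarrow>
     continuous_on (D \<times> {0..1}) H \<and> H \<in> D \<times> {0..1} \<rightarrow> E \<and>
     (\<forall>x\<in>D. \<forall>x'\<in>D. \<forall>t\<in>{0..1}. p x = p x' \<longrightarrow> q (H (x, t)) = q (H (x', t)))"

definition deck_gottlieb ::
  "'d::topological_space set \<Rightarrow> ('d \<Rightarrow> 'x) \<Rightarrow> 'e::topological_space set \<Rightarrow> ('e \<Rightarrow> 'y) \<Rightarrow>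
   ('d \<Rightarrow> 'e) \<Rightarrow> ('e \<Rightarrow> 'e) set" where
  "deck_gottlieb D p E q g =
     {h \<in> deck_transformations E q.
        \<exists>H. fibre_preserving_homotopy D p E q H \<and>
            (\<forall>x\<in>D. H (x, 0) = g x) \<and> (\<forall>x\<in>D. H (x, 1) = h (g x))}"

end

theory Submission
  imports Defs "HOL-Algebra.Coset"
begin

text \<open>
  A homotopy \<open>H\<close> from \<open>f\<close> to itself is pulled back along \<open>p\<close> and lifted through \<open>q\<close>, starting at the
  given lifting \<open>f\<^sub>0\<close>. The end of the lifted homotopy is again a lifting of \<open>f\<close>, so by unique
  lifting it is \<open>h f\<^sub>0\<close> for the deck transformation \<open>h\<close> that corresponds to the loop \<open>H(x\<^sub>0, -)\<close>.
  Conversely, a fibre-preserving homotopy from \<open>f\<^sub>0\<close> to \<open>h f\<^sub>0\<close> descends along the quotient map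
  \<open>p \<times> id\<close> to such an \<open>H\<close>. Concatenation of homotopies makes the classes of the loops
  \<open>H(x\<^sub>0, -)\<close> a subgroup.
\<close>

subsection \<open>Lifts through a covering\<close>

text \<open>The lifting theorems of HOL-Analysis assume that all spaces lie in normed vector spaces.\<close>

definition evenly_covered ::
  "'e::topological_space set \<Rightarrow> ('e \<Rightarrow> 'b::topological_space) \<Rightarrow> 'b set \<Rightarrow> 'e set set \<Rightarrow> bool" where
  "evenly_covered E q W \<U> \<longleftrightarrow>
     \<Union>\<U> = E \<inter> q -` W \<and> pairwise disjnt \<U> \<and>
     (\<forall>U\<in>\<U>. openin (top_of_set E) U \<and> (\<exists>s. homeomorphism U W q s))"

lemma covering_space_evenly_covered:
  assumes "covering_space E q B" "b \<in> B"
  obtains W \<U> where "b \<in> W" "openin (top_of_set B) W" "evenly_covered E q W \<U>"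
  using assms unfolding covering_space_def evenly_covered_def by metis

lemma evenly_covered_sheet:
  assumes "evenly_covered E q W \<U>" "e \<in> E" "q e \<in> W"
  obtains U s where "U \<in> \<U>" "e \<in> U" "openin (top_of_set E) U" "homeomorphism U W q s"
proof -
  have "e \<in> \<Union>\<U>" using assms by (auto simp: evenly_covered_def)
  then show ?thesis using assms(1) that unfolding evenly_covered_def by blast
qed

lemma covering_space_imp_open_map:
  assumes "covering_space E q B"
  shows "open_map (top_of_set E) (top_of_set B) q"
  unfolding open_map_def
proof (intro allI impI)
  fix T assume T: "openin (top_of_set E) T"
  show "openin (top_of_set B) (q ` T)"
  proof (subst openin_subopen, intro ballI)
    fix y assume "y \<in> q ` T"
    then obtain e where e: "e \<in> T" "y = q e" by blast
    then have "e \<in> E" using openin_imp_subset[OF T] by blast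
    then obtain U W s where "e \<in> U" "openin (top_of_set E) U" "openin (top_of_set B) W"
      and s: "homeomorphism U W q s"
      using covering_space_local_homeomorphism[OF assms] by metis
    have "openin (top_of_set E) (U \<inter> T)" using \<open>openin (top_of_set E) U\<close> T by (rule openin_Int)
    then have "openin (top_of_set U) (U \<inter> T)"
      by (rule openin_subset_trans) (use openin_imp_subset[OF \<open>openin (top_of_set E) U\<close>] in auto)
    then have "openin (top_of_set W) (q ` (U \<inter> T))"
      by (rule homeomorphism_imp_open_map[OF s])
    then have "openin (top_of_set B) (q ` (U \<inter> T))"
      using \<open>openin (top_of_set B) W\<close> openin_trans by blast
    then show "\<exists>N. openin (top_of_set B) N \<and> y \<in> N \<and> N \<subseteq> q ` T"
      using e \<open>e \<in> U\<close> by blast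
  qed
qed

lemma lifting_of_preimage_open:
  assumes "lifting_of T r E q f g" "openin (top_of_set E) U"
  shows "openin (top_of_set T) (T \<inter> g -` U)"
  using assms by (auto simp: lifting_of_def intro: continuous_openin_preimage)

lemma lifting_of_subset:
  "\<lbrakk>lifting_of T r E q f g; S \<subseteq> T\<rbrakk> \<Longrightarrow> lifting_of S r E q f g"
  using continuous_on_subset[of T g S] by (auto simp: lifting_of_def)

lemma openin_lifts_agree:
  assumes cov: "covering_space E q B"
    and g1: "lifting_of T r E q f g1" and g2: "lifting_of T r E q f g2"
  shows "openin (top_of_set T) {x \<in> T. g1 x = g2 x}"
proof (subst openin_subopen, clarify)
  fix x assume x: "x \<in> T" "g1 x = g2 x"
  from x(1) have "g1 x \<in> E" using g1 by (auto simp: lifting_of_def)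
  then obtain U W s where U: "g1 x \<in> U" "openin (top_of_set E) U" "homeomorphism U W q s"
    using covering_space_local_homeomorphism[OF cov] by metis
  then have inj: "inj_on q U" by (auto simp: homeomorphism_def intro: inj_on_inverseI)
  let ?N = "T \<inter> g1 -` U \<inter> (T \<inter> g2 -` U)"
  have "openin (top_of_set T) ?N"
    using lifting_of_preimage_open[OF g1 U(2)] lifting_of_preimage_open[OF g2 U(2)]
    by (rule openin_Int)
  moreover have "x \<in> ?N" using x U(1) by simp
  moreover have "?N \<subseteq> {x \<in> T. g1 x = g2 x}"
    using g1 g2 by (auto simp: lifting_of_def intro: inj_onD[OF inj])
  ultimately show "\<exists>N. openin (top_of_set T) N \<and> x \<in> N \<and> N \<subseteq> {x \<in> T. g1 x = g2 x}" by blast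
qed

lemma openin_lifts_disagree:
  assumes cov: "covering_space E q B"
    and g1: "lifting_of T r E q f g1" and g2: "lifting_of T r E q f g2"
  shows "openin (top_of_set T) {x \<in> T. g1 x \<noteq> g2 x}"
proof (subst openin_subopen, clarify)
  fix x assume x: "x \<in> T" "g1 x \<noteq> g2 x"
  then have E: "g1 x \<in> E" "g2 x \<in> E" and same_image: "q (g1 x) = q (g2 x)"
    using g1 g2 by (auto simp: lifting_of_def)
  then have "q (g1 x) \<in> B" using covering_space_imp_surjective[OF cov] by blast
  then obtain W \<U> where W: "q (g1 x) \<in> W" "evenly_covered E q W \<U>"
    by (rule covering_space_evenly_covered[OF cov])
  obtain U1 s1 where U1: "U1 \<in> \<U>" "g1 x \<in> U1" "openin (top_of_set E) U1" "homeomorphism U1 W q s1"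
    using evenly_covered_sheet[OF W(2) E(1) W(1)] .
  obtain U2 s2 where U2: "U2 \<in> \<U>" "g2 x \<in> U2" "openin (top_of_set E) U2" "homeomorphism U2 W q s2"
    using evenly_covered_sheet[OF W(2) E(2)] W(1) same_image by metis
  have "U1 \<noteq> U2" using x(2) same_image U1 U2 by (metis homeomorphism_apply1)
  then have "disjnt U1 U2" using W(2) U1(1) U2(1) by (auto simp: evenly_covered_def pairwise_def)
  let ?N = "T \<inter> g1 -` U1 \<inter> (T \<inter> g2 -` U2)"
  have "openin (top_of_set T) ?N"
    using lifting_of_preimage_open[OF g1 U1(3)] lifting_of_preimage_open[OF g2 U2(3)]
    by (rule openin_Int)
  moreover have "x \<in> ?N" using x U1 U2 by simp
  moreover have "?N \<subseteq> {x \<in> T. g1 x \<noteq> g2 x}" using \<open>disjnt U1 U2\<close> by (auto simp: disjnt_iff)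
  ultimately show "\<exists>N. openin (top_of_set T) N \<and> x \<in> N \<and> N \<subseteq> {x \<in> T. g1 x \<noteq> g2 x}" by blast
qed

lemma lifting_of_unique:
  assumes cov: "covering_space E q B"
    and lifts: "lifting_of T r E q f g1" "lifting_of T r E q f g2"
    and "connected T" "a \<in> T" "g1 a = g2 a" "x \<in> T"
  shows "g1 x = g2 x"
proof -
  let ?A = "{x \<in> T. g1 x = g2 x}"
  have "T - ?A = {x \<in> T. g1 x \<noteq> g2 x}" by blast
  then have "closedin (top_of_set T) ?A"
    using openin_lifts_disagree[OF cov lifts] by (simp add: closedin_def)
  moreover note openin_lifts_agree[OF cov lifts]
  ultimately have "?A = {} \<or> ?A = T"
    using \<open>connected T\<close> unfolding connected_clopen by blast
  then show ?thesis using assms by blast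
qed

definition locally_liftable ::
  "'e::topological_space set \<Rightarrow> ('e \<Rightarrow> 'b) \<Rightarrow> 'z::topological_space set \<Rightarrow> ('z \<times> real \<Rightarrow> 'b) \<Rightarrow>
   'z \<Rightarrow> real \<Rightarrow> real \<Rightarrow> bool" where
  "locally_liftable E q Z H z a b \<longleftrightarrow>
     (\<forall>V g. openin (top_of_set Z) V \<and> z \<in> V \<and> lifting_of V (\<lambda>x. (x, a)) E q H g \<longrightarrow>
        (\<exists>V' K. openin (top_of_set Z) V' \<and> z \<in> V' \<and> V' \<subseteq> V \<and>
                lifting_of (V' \<times> {a..b}) id E q H K \<and> (\<forall>x\<in>V'. K (x, a) = g x)))"

lemma locally_liftableE:
  assumes "locally_liftable E q Z H z a b"
    and "openin (top_of_set Z) V" "z \<in> V" "lifting_of V (\<lambda>x. (x, a)) E q H g"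
  obtains V' K where "openin (top_of_set Z) V'" "z \<in> V'" "V' \<subseteq> V"
    "lifting_of (V' \<times> {a..b}) id E q H K" "\<And>x. x \<in> V' \<Longrightarrow> K (x, a) = g x"
  using assms unfolding locally_liftable_def by metis

lemma continuous_on_slice:
  assumes "continuous_on (S \<times> T) h" "t \<in> T"
  shows "continuous_on S (\<lambda>x. h (x, t))"
  by (rule continuous_on_compose2[OF assms(1)]) (use assms(2) in \<open>auto intro!: continuous_intros\<close>)

lemma lifting_of_slice:
  assumes "lifting_of (V \<times> T) r E q H K" "t \<in> T"
  shows "lifting_of V (\<lambda>x. r (x, t)) E q H (\<lambda>x. K (x, t))"
  using assms continuous_on_slice[of V T K t] by (auto simp: lifting_of_def)

lemma lifting_of_concat:
  fixes K1 K2 :: "'z::topological_space \<times> real \<Rightarrow> 'e::topological_space"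
  assumes "lifting_of (V \<times> {a..b}) id E q H K1" "lifting_of (V \<times> {b..c}) id E q H K2"
    and "\<And>x. x \<in> V \<Longrightarrow> K2 (x, b) = K1 (x, b)"
  shows "lifting_of (V \<times> {a..c}) id E q H (\<lambda>w. if snd w \<le> b then K1 w else K2 w)"
proof -
  have "continuous_on (V \<times> {a..c}) (\<lambda>w. if snd w \<le> b then K1 w else K2 w)"
  proof (rule continuous_on_cases_le)
    show "continuous_on {w \<in> V \<times> {a..c}. snd w \<le> b} K1"
      by (rule continuous_on_subset[of "V \<times> {a..b}"]) (use assms(1) in \<open>auto simp: lifting_of_def\<close>)
    show "continuous_on {w \<in> V \<times> {a..c}. b \<le> snd w} K2"
      by (rule continuous_on_subset[of "V \<times> {b..c}"]) (use assms(2) in \<open>auto simp: lifting_of_def\<close>)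
  qed (use assms(3) in \<open>auto intro!: continuous_intros\<close>)
  then show ?thesis using assms(1,2) by (auto simp: lifting_of_def Pi_iff)
qed

lemma locally_liftable_trans:
  assumes ab: "locally_liftable E q Z H z a b" and bc: "locally_liftable E q Z H z b c"
    and "a \<le> b" "b \<le> c"
  shows "locally_liftable E q Z H z a c"
  unfolding locally_liftable_def
proof (intro allI impI, elim conjE)
  fix V g assume "openin (top_of_set Z) V" "z \<in> V" "lifting_of V (\<lambda>x. (x, a)) E q H g"
  with ab obtain V1 K1 where V1: "openin (top_of_set Z) V1" "z \<in> V1" "V1 \<subseteq> V"
    and K1: "lifting_of (V1 \<times> {a..b}) id E q H K1" "\<And>x. x \<in> V1 \<Longrightarrow> K1 (x, a) = g x"
    by (rule locally_liftableE) blast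
  have "lifting_of V1 (\<lambda>x. (x, b)) E q H (\<lambda>x. K1 (x, b))"
    using lifting_of_slice[OF K1(1), of b] \<open>a \<le> b\<close> by simp
  with bc V1(1,2) obtain V2 K2 where V2: "openin (top_of_set Z) V2" "z \<in> V2" "V2 \<subseteq> V1"
    and K2: "lifting_of (V2 \<times> {b..c}) id E q H K2" "\<And>x. x \<in> V2 \<Longrightarrow> K2 (x, b) = K1 (x, b)"
    by (rule locally_liftableE) blast
  let ?K = "\<lambda>w. if snd w \<le> b then K1 w else K2 w"
  have "lifting_of (V2 \<times> {a..b}) id E q H K1"
    by (rule lifting_of_subset[OF K1(1)]) (use V2(3) in auto)
  then have "lifting_of (V2 \<times> {a..c}) id E q H ?K"
    using K2 by (rule lifting_of_concat)
  moreover have "\<forall>x\<in>V2. ?K (x, a) = g x" using K1(2) V2(3) \<open>a \<le> b\<close> by auto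
  ultimately show "\<exists>V' K. openin (top_of_set Z) V' \<and> z \<in> V' \<and> V' \<subseteq> V \<and>
      lifting_of (V' \<times> {a..c}) id E q H K \<and> (\<forall>x\<in>V'. K (x, a) = g x)"
    using V1(3) V2 by blast
qed

lemma locally_liftable_evenly_covered:
  assumes cov: "evenly_covered E q W \<U>"
    and N: "openin (top_of_set Z) N" "z \<in> N"
    and H: "continuous_on (N \<times> {a..b}) H" "H \<in> N \<times> {a..b} \<rightarrow> W" and "a \<le> b"
  shows "locally_liftable E q Z H z a b"
  unfolding locally_liftable_def
proof (intro allI impI, elim conjE)
  fix V g assume V: "openin (top_of_set Z) V" "z \<in> V" and g: "lifting_of V (\<lambda>x. (x, a)) E q H g"
  have "g z \<in> E" "q (g z) \<in> W" using g V(2) N(2) H(2) \<open>a \<le> b\<close> by (auto simp: lifting_of_def)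
  with cov obtain U s where U: "g z \<in> U" "openin (top_of_set E) U" and s: "homeomorphism U W q s"
    by (rule evenly_covered_sheet)
  define V' where "V' = (V \<inter> g -` U) \<inter> N"
  have "openin (top_of_set Z) (V \<inter> g -` U)"
    using lifting_of_preimage_open[OF g U(2)] V(1) by (rule openin_trans)
  then have "openin (top_of_set Z) V'" using N(1) unfolding V'_def by (rule openin_Int)
  moreover have "z \<in> V'" "V' \<subseteq> V" using V(2) U(1) N(2) by (auto simp: V'_def)
  moreover have "lifting_of (V' \<times> {a..b}) id E q H (s \<circ> H)"
  proof -
    have "V' \<times> {a..b} \<subseteq> N \<times> {a..b}" by (auto simp: V'_def)
    then have "continuous_on (V' \<times> {a..b}) H" and HW: "\<And>w. w \<in> V' \<times> {a..b} \<Longrightarrow> H w \<in> W"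
      using H continuous_on_subset by blast+
    then have "continuous_on (V' \<times> {a..b}) (s \<circ> H)"
      by (intro continuous_on_compose continuous_on_subset[OF homeomorphism_cont2[OF s]]) auto
    moreover have "s y \<in> E" "q (s y) = y" if "y \<in> W" for y
      using s that openin_imp_subset[OF U(2)] by (auto simp: homeomorphism_def)
    ultimately show ?thesis using HW by (simp add: lifting_of_def)
  qed
  moreover have "\<forall>x\<in>V'. (s \<circ> H) (x, a) = g x"
  proof
    fix x assume "x \<in> V'"
    then have "q (g x) = H (x, a)" "g x \<in> U" using g by (auto simp: V'_def lifting_of_def)
    then show "(s \<circ> H) (x, a) = g x" using homeomorphism_apply1[OF s, of "g x"] by simp
  qed
  ultimately show "\<exists>V' K. openin (top_of_set Z) V' \<and> z \<in> V' \<and> V' \<subseteq> V \<and>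
      lifting_of (V' \<times> {a..b}) id E q H K \<and> (\<forall>x\<in>V'. K (x, a) = g x)"
    by blast
qed

lemma locally_liftable_short_time:
  assumes cov: "covering_space E q B"
    and H: "continuous_on (Z \<times> {0..1}) H" "H \<in> Z \<times> {0..1} \<rightarrow> B" and z: "z \<in> Z" and t: "t \<in> {0..1}"
  obtains d where "d > 0"
    "\<And>a b. \<lbrakk>a \<le> t; t \<le> b; b - a < d; {a..b} \<subseteq> {0..1}\<rbrakk> \<Longrightarrow> locally_liftable E q Z H z a b"
proof -
  have "H (z, t) \<in> B" using H(2) z t by auto
  then obtain W \<U> where W: "H (z, t) \<in> W" "openin (top_of_set B) W" and \<U>: "evenly_covered E q W \<U>"
    by (rule covering_space_evenly_covered[OF cov])
  obtain S where S: "open S" "Z \<times> {0..1} \<inter> H -` W = Z \<times> {0..1} \<inter> S"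
    using continuous_openin_preimage[OF H W(2)] unfolding openin_open by blast
  moreover have "(z, t) \<in> Z \<times> {0..1} \<inter> H -` W" using W(1) z t by simp
  ultimately have "(z, t) \<in> S" by blast
  then obtain A C where AC: "open A" "open C" "z \<in> A" "t \<in> C" "A \<times> C \<subseteq> S"
    using open_prod_elim[OF S(1)] by (metis mem_Sigma_iff)
  then obtain d where d: "d > 0" "ball t d \<subseteq> C" using open_contains_ball by metis
  show ?thesis
  proof (rule that[OF d(1)])
    fix a b assume ab: "a \<le> t" "t \<le> b" "b - a < d" "{a..b} \<subseteq> {0..1}"
    have "{a..b} \<subseteq> C" using ab d(2) by (auto simp: subset_iff dist_real_def)
    then have "H \<in> (Z \<inter> A) \<times> {a..b} \<rightarrow> W" using S(2) AC(5) ab(4) by blast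
    moreover have "continuous_on ((Z \<inter> A) \<times> {a..b}) H"
      by (rule continuous_on_subset[OF H(1)]) (use ab(4) in auto)
    moreover have "openin (top_of_set Z) (Z \<inter> A)" "z \<in> Z \<inter> A" using AC z by auto
    ultimately show "locally_liftable E q Z H z a b"
      using ab by (intro locally_liftable_evenly_covered[OF \<U>]) auto
  qed
qed

lemma locally_liftable_unit_interval:
  assumes "covering_space E q B" "continuous_on (Z \<times> {0..1}) H" "H \<in> Z \<times> {0..1} \<rightarrow> B" "z \<in> Z"
  shows "locally_liftable E q Z H z 0 1"
proof -
  have "{0..1} \<subseteq> {0..1::real} \<longrightarrow> locally_liftable E q Z H z 0 1"
  proof (rule Bolzano[where P = "\<lambda>a b. {a..b} \<subseteq> {0..1} \<longrightarrow> locally_liftable E q Z H z a b"])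
    fix a b c :: real
    assume "{a..b} \<subseteq> {0..1} \<longrightarrow> locally_liftable E q Z H z a b"
      "{b..c} \<subseteq> {0..1} \<longrightarrow> locally_liftable E q Z H z b c" "a \<le> b" "b \<le> c"
    then show "{a..c} \<subseteq> {0..1} \<longrightarrow> locally_liftable E q Z H z a c"
      using locally_liftable_trans[of E q Z H z a b c] by auto
  next
    fix t :: real assume "0 \<le> t" "t \<le> 1"
    then obtain d where "d > 0"
      "\<And>a b. \<lbrakk>a \<le> t; t \<le> b; b - a < d; {a..b} \<subseteq> {0..1}\<rbrakk> \<Longrightarrow> locally_liftable E q Z H z a b"
      using locally_liftable_short_time[OF assms, of t] by auto
    then show "\<exists>d>0. \<forall>a b. a \<le> t \<and> t \<le> b \<and> b - a < d \<longrightarrow>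
        {a..b} \<subseteq> {0..1} \<longrightarrow> locally_liftable E q Z H z a b"
      by blast
  qed simp
  then show ?thesis by simp
qed

lemma lifting_of_path_unique:
  assumes "covering_space E q B" "lifting_of {0..1::real} r E q \<alpha> \<gamma>" "lifting_of {0..1} r E q \<alpha> \<delta>"
    and "\<gamma> 0 = \<delta> 0" "t \<in> {0..1}"
  shows "\<gamma> t = \<delta> t"
  using lifting_of_unique[OF assms(1-3), of 0] assms(4,5) by simp

lemma lifting_of_track:
  assumes "lifting_of (V \<times> T) r E q H K" "x \<in> V"
  shows "lifting_of T (\<lambda>t. r (x, t)) E q H (\<lambda>t. K (x, t))"
  using assms continuous_on_o_Pair[of V T K x] by (auto simp: lifting_of_def o_def)

lemma lifting_of_pasting:
  fixes K :: "'z::topological_space \<Rightarrow> 'z \<times> 't::topological_space \<Rightarrow> 'e::topological_space"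
  assumes V: "\<And>z. z \<in> Z \<Longrightarrow> openin (top_of_set Z) (V z)" "\<And>z. z \<in> Z \<Longrightarrow> z \<in> V z"
    and K: "\<And>z. z \<in> Z \<Longrightarrow> lifting_of (V z \<times> T) id E q H (K z)"
    and agree: "\<And>i j x t. \<lbrakk>i \<in> Z; j \<in> Z; x \<in> V i; x \<in> V j; t \<in> T\<rbrakk> \<Longrightarrow> K i (x, t) = K j (x, t)"
  shows "lifting_of (Z \<times> T) id E q H (\<lambda>w. K (fst w) w)"
proof -
  have "continuous_map (top_of_set (Z \<times> T)) euclidean (\<lambda>w. K (fst w) w)"
  proof (rule pasting_lemma[where I = Z and T = "\<lambda>z. V z \<times> T" and f = K])
    fix i assume i: "i \<in> Z"
    show "openin (top_of_set (Z \<times> T)) (V i \<times> T)" using V(1)[OF i] by (simp add: openin_Times)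
    have "V i \<subseteq> Z" by (rule openin_imp_subset[OF V(1)[OF i]])
    then show "continuous_map (subtopology (top_of_set (Z \<times> T)) (V i \<times> T)) euclidean (K i)"
      using K[OF i]
      by (simp add: lifting_of_def subtopology_subtopology Int_absorb1 Times_Int_Times)
  next
    fix i j w assume "i \<in> Z" "j \<in> Z" "w \<in> topspace (top_of_set (Z \<times> T)) \<inter> V i \<times> T \<inter> V j \<times> T"
    then show "K i w = K j w" using agree[of i j "fst w" "snd w"] by auto
  next
    fix w assume "w \<in> topspace (top_of_set (Z \<times> T))"
    then show "\<exists>z. z \<in> Z \<and> w \<in> V z \<times> T \<and> K (fst w) w = K z w"
      using V(2) by (intro exI[of _ "fst w"]) auto
  qed
  moreover have "K (fst w) w \<in> E \<and> q (K (fst w) w) = H w" if "w \<in> Z \<times> T" for w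
  proof -
    have "w \<in> V (fst w) \<times> T" "fst w \<in> Z" using that V(2) by auto
    then show ?thesis using K[of "fst w"] by (auto simp: lifting_of_def)
  qed
  ultimately show ?thesis by (simp add: lifting_of_def)
qed

theorem covering_homotopy_lifting:
  fixes H :: "'z::topological_space \<times> real \<Rightarrow> 'b::topological_space"
  assumes cov: "covering_space E q B"
    and H: "continuous_on (Z \<times> {0..1}) H" "H \<in> Z \<times> {0..1} \<rightarrow> B"
    and g: "lifting_of Z (\<lambda>z. (z, 0)) E q H g"
  obtains K where "lifting_of (Z \<times> {0..1}) id E q H K" "\<And>z. z \<in> Z \<Longrightarrow> K (z, 0) = g z"
proof -
  define lifts_near where "lifts_near z V K \<longleftrightarrow> openin (top_of_set Z) V \<and> z \<in> V \<and>
    lifting_of (V \<times> {0..1}) id E q H K \<and> (\<forall>x\<in>V. K (x, 0) = g x)" for z V K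
  have "\<exists>V K. lifts_near z V K" if "z \<in> Z" for z
    using locally_liftableE[OF locally_liftable_unit_interval[OF cov H that] _ that g]
    unfolding lifts_near_def by (metis openin_subtopology_self)
  then obtain V K where "\<And>z. z \<in> Z \<Longrightarrow> lifts_near z (V z) (K z)" by metis
  then have V: "\<And>z. z \<in> Z \<Longrightarrow> openin (top_of_set Z) (V z)" "\<And>z. z \<in> Z \<Longrightarrow> z \<in> V z"
    and K: "\<And>z. z \<in> Z \<Longrightarrow> lifting_of (V z \<times> {0..1}) id E q H (K z)"
      "\<And>z x. \<lbrakk>z \<in> Z; x \<in> V z\<rbrakk> \<Longrightarrow> K z (x, 0) = g x"
    unfolding lifts_near_def by blast+
  have agree: "K i (x, t) = K j (x, t)"
    if "i \<in> Z" "j \<in> Z" "x \<in> V i" "x \<in> V j" "t \<in> {0..1}" for i j x t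
  proof -
    have "lifting_of {0..1} (\<lambda>t. (x, t)) E q H (\<lambda>t. K i (x, t))"
      "lifting_of {0..1} (\<lambda>t. (x, t)) E q H (\<lambda>t. K j (x, t))"
      using lifting_of_track[OF K(1)] that by fastforce+
    then show ?thesis by (rule lifting_of_path_unique[OF cov]) (use K(2) that in simp_all)
  qed
  have "lifting_of (Z \<times> {0..1}) id E q H (\<lambda>w. K (fst w) w)"
    by (rule lifting_of_pasting[where V = V and T = "{0..1}"]) (fact V K(1) agree)+
  then show ?thesis using that K(2) V(2) by simp
qed

lemma path_lift_iff_lifting_of:
  "path_lift E q e \<alpha> \<gamma> \<longleftrightarrow> lifting_of {0..1} id E q \<alpha> \<gamma> \<and> \<gamma> 0 = e"
  by (auto simp: path_lift_def lifting_of_def path_def path_image_def pathstart_def)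

lemma path_lift_exists:
  assumes cov: "covering_space E q B" and "e \<in> E"
    and \<alpha>: "path \<alpha>" "path_image \<alpha> \<subseteq> B" "pathstart \<alpha> = q e"
  obtains \<gamma> where "path_lift E q e \<alpha> \<gamma>"
proof -
  let ?H = "\<lambda>w :: real \<times> real. \<alpha> (snd w)"
  have "continuous_on ({0} \<times> {0..1}) ?H"
    by (rule continuous_on_compose2[of "{0..1}" \<alpha>])
      (use \<alpha>(1) in \<open>auto simp: path_def intro!: continuous_intros\<close>)
  moreover have "?H \<in> {0} \<times> {0..1} \<rightarrow> B" using \<alpha>(2) by (auto simp: path_image_def)
  moreover have "lifting_of {0} (\<lambda>z. (z, 0)) E q ?H (\<lambda>_. e)"
    using \<alpha>(3) \<open>e \<in> E\<close> by (simp add: lifting_of_def pathstart_def)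
  ultimately obtain K where "lifting_of ({0} \<times> {0..1}) id E q ?H K" "K (0, 0) = e"
    using covering_homotopy_lifting[OF cov] by (metis singletonI)
  then have "path_lift E q e \<alpha> (\<lambda>t. K (0, t))"
    using lifting_of_track[of "{0}" "{0..1}" id E q ?H K 0]
    by (simp add: path_lift_iff_lifting_of lifting_of_def)
  then show ?thesis by (rule that)
qed

lemma path_lift_unique:
  assumes "covering_space E q B" "path_lift E q e \<alpha> \<gamma>" "path_lift E q e \<alpha> \<delta>" "t \<in> {0..1}"
  shows "\<gamma> t = \<delta> t"
  using lifting_of_path_unique[of E q B id \<alpha> \<gamma> \<delta> t] assms by (simp add: path_lift_iff_lifting_of)

lemma path_lift_homotopic_pathfinish:
  assumes cov: "covering_space E q B" and "homotopic_paths B \<alpha> \<beta>"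
    and \<gamma>: "path_lift E q e \<alpha> \<gamma>" and \<delta>: "path_lift E q e \<beta> \<delta>"
  shows "pathfinish \<gamma> = pathfinish \<delta>"
proof -
  have e: "e \<in> E" "q e = \<alpha> 0" using \<gamma> by (auto simp: path_lift_iff_lifting_of lifting_of_def)
  obtain h where h: "continuous_on ({0..1} \<times> {0..1}) h" "h \<in> {0..1} \<times> {0..1} \<rightarrow> B"
    "\<And>t. t \<in> {0..1} \<Longrightarrow> h (0, t) = \<alpha> t" "\<And>t. t \<in> {0..1} \<Longrightarrow> h (1, t) = \<beta> t"
    "\<And>s::real. s \<in> {0..1} \<Longrightarrow> h (s, 0) = \<alpha> 0" "\<And>s. s \<in> {0..1} \<Longrightarrow> h (s, 1) = \<alpha> 1"
    using assms(2) unfolding homotopic_paths pathstart_def pathfinish_def by auto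
  have "lifting_of {0..1} (\<lambda>s. (s, 0)) E q h (\<lambda>_. e)"
    using e h(5) by (simp add: lifting_of_def)
  then obtain K where K: "lifting_of ({0..1} \<times> {0..1}) id E q h K"
    and K0: "\<And>s. s \<in> {0..1} \<Longrightarrow> K (s, 0) = e"
    using covering_homotopy_lifting[OF cov h(1,2)] by metis
  have "path_lift E q e \<alpha> (\<lambda>t. K (0, t))" "path_lift E q e \<beta> (\<lambda>t. K (1, t))"
    using lifting_of_track[OF K, of 0] lifting_of_track[OF K, of 1] h(3,4) K0
    by (simp_all add: path_lift_iff_lifting_of lifting_of_def)
  then have "\<gamma> 1 = K (0, 1)" "\<delta> 1 = K (1, 1)"
    using path_lift_unique[OF cov \<gamma>, of _ 1] path_lift_unique[OF cov \<delta>, of _ 1] by simp_all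
  moreover have "K (1, 1) = K (0, 1)"
  proof (rule lifting_of_path_unique[OF cov, where \<gamma> = "\<lambda>s. K (s, 1)"
        and \<delta> = "\<lambda>_. K (0, 1)" and t = 1])
    show "lifting_of {0..1} (\<lambda>s. (s, 1)) E q h (\<lambda>s. K (s, 1))"
      using lifting_of_slice[OF K, of 1] by simp
    then show "lifting_of {0..1} (\<lambda>s. (s, 1)) E q h (\<lambda>_. K (0, 1))"
      using h(6) by (auto simp: lifting_of_def)
  qed simp_all
  ultimately show ?thesis by (simp add: pathfinish_def)
qed

subsection \<open>The fundamental group\<close>

lemma homotopic_paths_convex_image:
  fixes C :: "'c::real_normed_vector set"
  assumes "convex C" "continuous_on C k" "k \<in> C \<rightarrow> S"
    and "path g" "path_image g \<subseteq> C" "path h" "path_image h \<subseteq> C"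
    and "pathstart g = pathstart h" "pathfinish g = pathfinish h"
  shows "homotopic_paths S (k \<circ> g) (k \<circ> h)"
proof -
  have "homotopic_paths C g h"
    using convex_imp_simply_connected[OF \<open>convex C\<close>] assms(4-9)
    unfolding simply_connected_eq_homotopic_paths by metis
  then show ?thesis using homotopic_paths_continuous_image assms(2,3) by blast
qed

lemma homotopic_paths_reparametrizations:
  fixes u v :: "real \<Rightarrow> real"
  assumes "path \<gamma>" "path_image \<gamma> \<subseteq> S"
    and "path u" "path_image u \<subseteq> {0..1}" "path v" "path_image v \<subseteq> {0..1}"
    and "pathstart u = pathstart v" "pathfinish u = pathfinish v"
  shows "homotopic_paths S (\<gamma> \<circ> u) (\<gamma> \<circ> v)"
  by (rule homotopic_paths_convex_image[of "{0..1}"])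
    (use assms in \<open>auto simp: path_def path_image_def\<close>)

lemma homotopic_paths_const_join:
  assumes "path \<gamma>" "path_image \<gamma> \<subseteq> S"
  shows "homotopic_paths S ((\<lambda>_. pathstart \<gamma>) +++ \<gamma>) \<gamma>"
  using homotopic_paths_reparametrizations[OF assms,
      of "linepath 0 0 +++ linepath 0 1" "linepath 0 1"]
  by (simp add: path_compose_join subset_path_image_join closed_segment_eq_real_ivl)
    (simp add: linepath_def o_def pathstart_def)

lemma homotopic_paths_join_reversepath:
  assumes "path \<gamma>" "path_image \<gamma> \<subseteq> S"
  shows "homotopic_paths S (\<gamma> +++ reversepath \<gamma>) (\<lambda>_. pathstart \<gamma>)"
  using homotopic_paths_reparametrizations[OF assms,
      of "linepath 0 1 +++ linepath 1 0" "linepath 0 0"]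
  by (simp add: path_compose_join subset_path_image_join closed_segment_eq_real_ivl)
    (simp add: linepath_def o_def pathstart_def reversepath_def)

lemma homotopic_paths_square:
  assumes u: "continuous_on ({0..1} \<times> {0..1}) u" "u \<in> {0..1::real} \<times> {0..1::real} \<rightarrow> S"
  shows "homotopic_paths S (\<lambda>t. u (0, t))
           ((\<lambda>s. u (s, 0)) +++ ((\<lambda>t. u (1, t)) +++ reversepath (\<lambda>s. u (s, 1))))"
proof -
  let ?Q = "{0..1::real} \<times> {0..1::real}"
  let ?left = "linepath (0, 0) (0, 1) :: real \<Rightarrow> real \<times> real"
  let ?rest = "linepath (0, 0) (1, 0) +++ (linepath (1, 0) (1, 1) +++ linepath (1, 1) (0, 1))
    :: real \<Rightarrow> real \<times> real"
  have "convex ?Q" by (intro convex_Times) auto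
  then have segment: "path_image (linepath v w) \<subseteq> ?Q" if "v \<in> ?Q" "w \<in> ?Q" for v w
    using that by (simp add: closed_segment_subset)
  have "path_image ?left \<subseteq> ?Q" "path_image ?rest \<subseteq> ?Q"
    by (intro subset_path_image_join segment; simp)+
  then have "homotopic_paths S (u \<circ> ?left) (u \<circ> ?rest)"
    by (intro homotopic_paths_convex_image[OF \<open>convex ?Q\<close> u]) simp_all
  then show ?thesis
    by (simp add: path_compose_join) (simp add: linepath_def o_def reversepath_def)
qed

lemma homotopic_loops_const_imp_homotopic_paths_const:
  assumes "homotopic_loops S \<gamma> (\<lambda>_. a)"
  shows "homotopic_paths S \<gamma> (\<lambda>_. pathstart \<gamma>)"
proof -
  obtain h where h: "continuous_on ({0..1} \<times> {0..1}) h" "h \<in> {0..1::real} \<times> {0..1::real} \<rightarrow> S"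
    "\<And>t. t \<in> {0..1} \<Longrightarrow> h (0, t) = \<gamma> t" "\<And>t. t \<in> {0..1} \<Longrightarrow> h (1, t) = a"
    "\<And>s. s \<in> {0..1} \<Longrightarrow> h (s, 1) = h (s, 0)"
    using assms unfolding homotopic_loops pathstart_def pathfinish_def by auto
  define \<beta> where "\<beta> s = h (s, 0)" for s
  have "continuous_on {0..1} \<beta>"
    unfolding \<beta>_def by (rule continuous_on_slice[OF h(1)]) simp
  then have \<beta>: "path \<beta>" "path_image \<beta> \<subseteq> S" and ends: "pathstart \<beta> = pathstart \<gamma>" "pathfinish \<beta> = a"
    using h by (auto simp: path_def path_image_def pathstart_def pathfinish_def \<beta>_def)
  have \<gamma>: "path \<gamma>" "path_image \<gamma> \<subseteq> S"
    using homotopic_loops_imp_path[OF assms] homotopic_loops_imp_subset[OF assms] by auto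
  have "homotopic_paths S \<gamma> (\<lambda>t. h (0, t))"
    by (rule homotopic_paths_eq[OF \<gamma>]) (simp add: h(3))
  also have "homotopic_paths S \<dots> (\<beta> +++ ((\<lambda>t. h (1, t)) +++ reversepath (\<lambda>s. h (s, 1))))"
    unfolding \<beta>_def by (rule homotopic_paths_square[OF h(1,2)])
  also have "homotopic_paths S \<dots> (\<beta> +++ ((\<lambda>_. a) +++ reversepath \<beta>))"
    using homotopic_paths_imp_path[OF calculation] homotopic_paths_imp_subset[OF calculation]
    by (intro homotopic_paths_eq) (auto simp: joinpaths_def reversepath_def \<beta>_def h(4,5))
  also have "homotopic_paths S \<dots> (\<beta> +++ reversepath \<beta>)"
  proof (rule homotopic_paths_join)
    show "homotopic_paths S ((\<lambda>_. a) +++ reversepath \<beta>) (reversepath \<beta>)"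
      using homotopic_paths_const_join[of "reversepath \<beta>" S] \<beta> ends(2) by simp
    show "pathfinish \<beta> = pathstart ((\<lambda>_. a) +++ reversepath \<beta>)"
      using ends(2) by simp (simp add: pathstart_def)
  qed (use \<beta> in simp)
  also have "homotopic_paths S \<dots> (\<lambda>_. pathstart \<gamma>)"
    using homotopic_paths_join_reversepath[OF \<beta>] ends(1) by simp
  finally show ?thesis .
qed

lemma loops_const: "y \<in> Y \<Longrightarrow> (\<lambda>_. y) \<in> loops Y y"
  by (auto simp: loops_def path_def path_image_def pathstart_def pathfinish_def)

lemma loops_join: "\<lbrakk>\<alpha> \<in> loops Y y; \<beta> \<in> loops Y y\<rbrakk> \<Longrightarrow> \<alpha> +++ \<beta> \<in> loops Y y"
  by (simp add: loops_def subset_path_image_join)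

lemma loops_reversepath: "\<alpha> \<in> loops Y y \<Longrightarrow> reversepath \<alpha> \<in> loops Y y"
  by (simp add: loops_def)

lemma simply_connected_imp_homotopic_loops:
  "\<lbrakk>simply_connected S; \<alpha> \<in> loops S a; \<beta> \<in> loops S b\<rbrakk> \<Longrightarrow> homotopic_loops S \<alpha> \<beta>"
  by (simp add: simply_connected_def loops_def)

lemma simply_connected_imp_path_connected_space:
  assumes "simply_connected S"
  shows "path_connected S"
  unfolding path_connected_def
proof (intro ballI)
  fix a b assume "a \<in> S" "b \<in> S"
  then have "homotopic_loops S (\<lambda>_. a) (\<lambda>_. b)"
    using assms by (blast intro: simply_connected_imp_homotopic_loops loops_const)
  then obtain h where h: "continuous_on ({0..1} \<times> {0..1}) h" "h \<in> {0..1::real} \<times> {0..1::real} \<rightarrow> S"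
    "\<And>t. t \<in> {0..1} \<Longrightarrow> h (0, t) = a" "\<And>t. t \<in> {0..1} \<Longrightarrow> h (1, t) = b"
    unfolding homotopic_loops by auto
  have "continuous_on {0..1} (\<lambda>s. h (s, 0))" by (rule continuous_on_slice[OF h(1)]) simp
  then show "\<exists>g. path g \<and> path_image g \<subseteq> S \<and> pathstart g = a \<and> pathfinish g = b"
    using h by (intro exI[of _ "\<lambda>s. h (s, 0)"])
      (auto simp: path_def path_image_def pathstart_def pathfinish_def)
qed

lemma simply_connected_imp_loops_null_homotopic:
  assumes "simply_connected S" "\<gamma> \<in> loops S a"
  shows "homotopic_paths S \<gamma> (\<lambda>_. a)"
proof -
  have "a \<in> S" using assms(2) by (auto simp: loops_def)
  then have "homotopic_loops S \<gamma> (\<lambda>_. a)"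
    using assms by (blast intro: simply_connected_imp_homotopic_loops loops_const)
  then have "homotopic_paths S \<gamma> (\<lambda>_. pathstart \<gamma>)"
    by (rule homotopic_loops_const_imp_homotopic_paths_const)
  then show ?thesis using assms(2) by (simp add: loops_def)
qed

lemma loop_class_eqI:
  assumes "homotopic_paths Y \<alpha> \<beta>"
  shows "loop_class Y \<alpha> = loop_class Y \<beta>"
  using assms homotopic_paths_sym homotopic_paths_trans unfolding loop_class_def by blast

lemma loop_class_self:
  assumes "\<alpha> \<in> loops Y y"
  shows "\<alpha> \<in> loop_class Y \<alpha>"
  using assms by (simp add: loop_class_def loops_def)

lemma carrier_fundamental_group: "carrier (fundamental_group Y y) = loop_class Y ` loops Y y"
  by (simp add: fundamental_group_def)

lemma one_fundamental_group: "\<one>\<^bsub>fundamental_group Y y\<^esub> = loop_class Y (\<lambda>_. y)"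
  by (simp add: fundamental_group_def)

lemma mult_fundamental_group:
  assumes "\<alpha> \<in> loops Y y" "\<beta> \<in> loops Y y"
  shows "loop_class Y \<alpha> \<otimes>\<^bsub>fundamental_group Y y\<^esub> loop_class Y \<beta> = loop_class Y (\<alpha> +++ \<beta>)"
proof -
  have "loop_class Y (\<alpha>' +++ \<beta>') = loop_class Y (\<alpha> +++ \<beta>)"
    if "\<alpha>' \<in> loop_class Y \<alpha>" "\<beta>' \<in> loop_class Y \<beta>" for \<alpha>' \<beta>'
    using that assms loop_class_eqI[OF homotopic_paths_join[of Y \<alpha> \<alpha>' \<beta> \<beta>']]
    by (simp add: loop_class_def loops_def)
  moreover have "loop_class Y \<alpha> \<noteq> {}" "loop_class Y \<beta> \<noteq> {}" using assms loop_class_self by blast+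
  ultimately have "(\<Union>\<alpha>'\<in>loop_class Y \<alpha>. \<Union>\<beta>'\<in>loop_class Y \<beta>. loop_class Y (\<alpha>' +++ \<beta>')) =
      loop_class Y (\<alpha> +++ \<beta>)"
    by simp
  then show ?thesis by (simp add: fundamental_group_def)
qed

lemma reversepath_mult_fundamental_group:
  assumes "\<alpha> \<in> loops Y y"
  shows "loop_class Y (reversepath \<alpha>) \<otimes>\<^bsub>fundamental_group Y y\<^esub> loop_class Y \<alpha> =
    \<one>\<^bsub>fundamental_group Y y\<^esub>"
proof -
  have "homotopic_paths Y (reversepath \<alpha> +++ \<alpha>) (\<lambda>_. y)"
    using homotopic_paths_join_reversepath[of "reversepath \<alpha>" Y] assms by (simp add: loops_def)
  then show ?thesis
    using assms
    by (simp add: mult_fundamental_group loops_reversepath one_fundamental_group loop_class_eqI)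
qed

lemma group_fundamental_group:
  assumes "y \<in> Y"
  shows "group (fundamental_group Y y)"
proof (rule groupI)
  let ?P = "fundamental_group Y y"
  show "a \<otimes>\<^bsub>?P\<^esub> b \<in> carrier ?P" if "a \<in> carrier ?P" "b \<in> carrier ?P" for a b
    using that by (auto simp: carrier_fundamental_group mult_fundamental_group loops_join)
  show "\<one>\<^bsub>?P\<^esub> \<in> carrier ?P"
    using assms by (simp add: carrier_fundamental_group one_fundamental_group loops_const)
  show "a \<otimes>\<^bsub>?P\<^esub> b \<otimes>\<^bsub>?P\<^esub> c = a \<otimes>\<^bsub>?P\<^esub> (b \<otimes>\<^bsub>?P\<^esub> c)"
    if abc: "a \<in> carrier ?P" "b \<in> carrier ?P" "c \<in> carrier ?P" for a b c
  proof -
    obtain \<alpha> \<beta> \<gamma> where "\<alpha> \<in> loops Y y" "\<beta> \<in> loops Y y" "\<gamma> \<in> loops Y y"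
      and "a = loop_class Y \<alpha>" "b = loop_class Y \<beta>" "c = loop_class Y \<gamma>"
      using abc by (auto simp: carrier_fundamental_group)
    moreover from this have "homotopic_paths Y (\<alpha> +++ (\<beta> +++ \<gamma>)) ((\<alpha> +++ \<beta>) +++ \<gamma>)"
      by (intro homotopic_paths_assoc) (auto simp: loops_def)
    ultimately show ?thesis
      by (simp add: mult_fundamental_group loops_join loop_class_eqI)
  qed
  show "\<one>\<^bsub>?P\<^esub> \<otimes>\<^bsub>?P\<^esub> a = a" if "a \<in> carrier ?P" for a
  proof -
    obtain \<alpha> where \<alpha>: "\<alpha> \<in> loops Y y" "a = loop_class Y \<alpha>"
      using \<open>a \<in> carrier ?P\<close> by (auto simp: carrier_fundamental_group)
    then have "homotopic_paths Y ((\<lambda>_. y) +++ \<alpha>) \<alpha>"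
      using homotopic_paths_const_join[of \<alpha> Y] by (simp add: loops_def)
    then show ?thesis
      using assms \<alpha>
      by (simp add: one_fundamental_group mult_fundamental_group loops_const loop_class_eqI)
  qed
  show "\<exists>b\<in>carrier ?P. b \<otimes>\<^bsub>?P\<^esub> a = \<one>\<^bsub>?P\<^esub>" if "a \<in> carrier ?P" for a
    using that reversepath_mult_fundamental_group loops_reversepath
    unfolding carrier_fundamental_group by blast
qed

lemma inv_fundamental_group:
  assumes "y \<in> Y" "\<alpha> \<in> loops Y y"
  shows "inv\<^bsub>fundamental_group Y y\<^esub> (loop_class Y \<alpha>) = loop_class Y (reversepath \<alpha>)"
  using assms reversepath_mult_fundamental_group[OF assms(2)]
  by (intro group.inv_equality[OF group_fundamental_group])
    (auto simp: carrier_fundamental_group loops_reversepath)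

subsection \<open>Deck transformations\<close>

lemma deck_transformationD:
  assumes "h \<in> deck_transformations E q"
  shows "continuous_on E h" "e \<in> E \<Longrightarrow> h e \<in> E" "e \<in> E \<Longrightarrow> q (h e) = q e" "h \<in> Bij E"
  using assms unfolding deck_transformations_def Bij_def homeomorphism_def
  by (auto simp: bij_betw_def inj_on_def) metis

lemma deck_transformation_id: "(\<lambda>x\<in>E. x) \<in> deck_transformations E q"
proof -
  have "homeomorphism E E (\<lambda>x\<in>E. x) (\<lambda>x. x)"
    by (rule homeomorphism_cong[OF homeomorphism_ident]) auto
  then show ?thesis by (auto simp: deck_transformations_def)
qed

lemma deck_transformation_compose:
  assumes "g \<in> deck_transformations E q" "h \<in> deck_transformations E q"
  shows "compose E g h \<in> deck_transformations E q"
proof -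
  obtain g' h' where "homeomorphism E E g g'" "homeomorphism E E h h'"
    using assms by (auto simp: deck_transformations_def)
  then have "homeomorphism E E (g \<circ> h) (h' \<circ> g')"
    using homeomorphism_compose by blast
  then have "homeomorphism E E (compose E g h) (h' \<circ> g')"
    by (rule homeomorphism_cong) (auto simp: compose_def)
  then show ?thesis
    using deck_transformationD[OF assms(1)] deck_transformationD[OF assms(2)]
    by (auto simp: deck_transformations_def compose_def)
qed

lemma deck_transformation_inverse:
  assumes h: "h \<in> deck_transformations E q"
  shows "restrict (inv_into E h) E \<in> deck_transformations E q"
proof -
  obtain k where k: "homeomorphism E E h k" using h by (auto simp: deck_transformations_def)
  then have kE: "k e \<in> E" "h (k e) = e" if "e \<in> E" for e
    using that by (auto simp: homeomorphism_def)
  have "inj_on h E" using k by (auto simp: homeomorphism_def intro: inj_on_inverseI)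
  then have inv_eq: "inv_into E h e = k e" if "e \<in> E" for e
    using kE that by (simp add: inv_into_f_eq)
  have "homeomorphism E E (restrict (inv_into E h) E) h"
    by (rule homeomorphism_cong[OF homeomorphism_symD[OF k]]) (simp_all add: inv_eq)
  moreover have "q (k e) = q e" if "e \<in> E" for e
    using deck_transformationD(3)[OF h, of "k e"] kE[OF that] by simp
  ultimately show ?thesis by (auto simp: deck_transformations_def inv_eq)
qed

lemma subgroup_deck_transformations: "subgroup (deck_transformations E q) (BijGroup E)"
proof (rule group.subgroupI[OF group_BijGroup])
  show "deck_transformations E q \<subseteq> carrier (BijGroup E)"
    using deck_transformationD(4) by (auto simp: BijGroup_def)
  show "deck_transformations E q \<noteq> {}" using deck_transformation_id by blast
  fix g h assume "g \<in> deck_transformations E q" "h \<in> deck_transformations E q"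
  moreover from this have "g \<in> Bij E" "h \<in> Bij E" by (auto dest: deck_transformationD(4))
  ultimately show "inv\<^bsub>BijGroup E\<^esub> g \<in> deck_transformations E q"
      "g \<otimes>\<^bsub>BijGroup E\<^esub> h \<in> deck_transformations E q"
    by (simp_all add: inv_BijGroup deck_transformation_inverse)
      (simp add: BijGroup_def deck_transformation_compose)
qed

lemma carrier_deck_group [simp]: "carrier (deck_group E q) = deck_transformations E q"
  by (simp add: deck_group_def)

lemma group_deck_group: "group (deck_group E q)"
  unfolding deck_group_def
  by (rule subgroup.subgroup_is_group[OF subgroup_deck_transformations group_BijGroup])

lemma one_deck_group: "\<one>\<^bsub>deck_group E q\<^esub> = (\<lambda>x\<in>E. x)"
  by (simp add: deck_group_def BijGroup_def)

lemma mult_deck_group: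
  "\<lbrakk>g \<in> deck_transformations E q; h \<in> deck_transformations E q\<rbrakk>
    \<Longrightarrow> g \<otimes>\<^bsub>deck_group E q\<^esub> h = compose E g h"
  using deck_transformationD(4)[of g E q] deck_transformationD(4)[of h E q]
  by (simp add: deck_group_def BijGroup_def)

lemma universal_covering_imp_covering_space: "universal_covering E q B \<Longrightarrow> covering_space E q B"
  by (simp add: universal_covering_def)

lemma universal_covering_imp_continuous: "universal_covering E q B \<Longrightarrow> continuous_on E q"
  by (intro covering_space_imp_continuous universal_covering_imp_covering_space)

lemma universal_covering_imp_surjective: "universal_covering E q B \<Longrightarrow> q ` E = B"
  by (intro covering_space_imp_surjective universal_covering_imp_covering_space)

lemma universal_covering_imp_path_connected: "universal_covering E q B \<Longrightarrow> path_connected E"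
  by (simp add: universal_covering_def simply_connected_imp_path_connected_space)

lemma deck_transformation_eqI:
  assumes "universal_covering E q B" "e \<in> E"
    and "g \<in> deck_transformations E q" "h \<in> deck_transformations E q" "g e = h e"
  shows "g = h"
proof -
  have "\<exists>!k. k \<in> deck_transformations E q \<and> k e = h e"
    using assms(1,2) deck_transformationD(2,3)[OF assms(4)] by (auto simp: universal_covering_def)
  then show ?thesis using assms(3-5) by blast
qed

lemma canonical_map_loop_class:
  assumes uc: "universal_covering E q B" and \<alpha>: "\<alpha> \<in> loops B (q e)" and \<gamma>: "path_lift E q e \<alpha> \<gamma>"
  shows "canonical_map E q e (loop_class B \<alpha>) \<in> deck_transformations E q"
    and "canonical_map E q e (loop_class B \<alpha>) e = pathfinish \<gamma>"
proof -
  have "e \<in> E" "pathfinish \<gamma> \<in> E" "q e = q (pathfinish \<gamma>)"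
    using \<alpha> \<gamma> by (auto simp: loops_def path_lift_iff_lifting_of lifting_of_def pathfinish_def)
  then have unique_deck: "\<exists>!h. h \<in> deck_transformations E q \<and> h e = pathfinish \<gamma>"
    using uc by (simp add: universal_covering_def)
  have "(\<exists>\<alpha>'\<in>loop_class B \<alpha>. \<exists>\<gamma>'. path_lift E q e \<alpha>' \<gamma>' \<and> h e = pathfinish \<gamma>') \<longleftrightarrow>
      h e = pathfinish \<gamma>" for h
  proof
    assume "\<exists>\<alpha>'\<in>loop_class B \<alpha>. \<exists>\<gamma>'. path_lift E q e \<alpha>' \<gamma>' \<and> h e = pathfinish \<gamma>'"
    then show "h e = pathfinish \<gamma>"
      using path_lift_homotopic_pathfinish[OF universal_covering_imp_covering_space[OF uc] _ \<gamma>]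
      by (auto simp: loop_class_def)
  qed (use loop_class_self[OF \<alpha>] \<gamma> in blast)
  then have "canonical_map E q e (loop_class B \<alpha>) =
      (THE h. h \<in> deck_transformations E q \<and> h e = pathfinish \<gamma>)"
    by (simp add: canonical_map_def)
  with theI'[OF unique_deck] show "canonical_map E q e (loop_class B \<alpha>) \<in> deck_transformations E q"
    and "canonical_map E q e (loop_class B \<alpha>) e = pathfinish \<gamma>" by auto
qed

lemma path_lift_join_deck_transformation:
  assumes \<gamma>: "path_lift E q e \<alpha> \<gamma>" and \<delta>: "path_lift E q e \<beta> \<delta>"
    and h: "h \<in> deck_transformations E q" "h e = pathfinish \<gamma>"
  shows "path_lift E q e (\<alpha> +++ \<beta>) (\<gamma> +++ (h \<circ> \<delta>))"
proof -
  have \<delta>E: "path \<delta>" "path_image \<delta> \<subseteq> E" "pathstart \<delta> = e" using \<delta> by (auto simp: path_lift_def)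
  then have "path (h \<circ> \<delta>)"
    using deck_transformationD(1)[OF h(1)]
    by (auto intro: path_continuous_image continuous_on_subset)
  moreover have "path_image (h \<circ> \<delta>) \<subseteq> E"
    using \<delta>E(2) deck_transformationD(2)[OF h(1)] by (auto simp: path_image_compose)
  moreover have "q ((h \<circ> \<delta>) t) = \<beta> t" if "t \<in> {0..1}" for t
  proof -
    have "\<delta> t \<in> E" using \<delta>E(2) that by (auto simp: path_image_def)
    then show ?thesis using \<delta> that deck_transformationD(3)[OF h(1)] by (simp add: path_lift_def)
  qed
  ultimately show ?thesis
    using \<gamma> h(2) \<delta>E(3) unfolding path_lift_def
    by (simp add: subset_path_image_join pathstart_compose) (simp add: joinpaths_def)
qed

context
  fixes E :: "'e::topological_space set" and q :: "'e \<Rightarrow> 'b::topological_space" and B :: "'b set"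
    and e :: 'e
  assumes uc: "universal_covering E q B" and e: "e \<in> E"
begin

lemma fundamental_group_representative:
  assumes "c \<in> carrier (fundamental_group B (q e))"
  obtains \<alpha> \<gamma> where "\<alpha> \<in> loops B (q e)" "c = loop_class B \<alpha>" "path_lift E q e \<alpha> \<gamma>"
proof -
  obtain \<alpha> where \<alpha>: "\<alpha> \<in> loops B (q e)" "c = loop_class B \<alpha>"
    using assms by (auto simp: carrier_fundamental_group)
  then obtain \<gamma> where "path_lift E q e \<alpha> \<gamma>"
    using path_lift_exists[OF universal_covering_imp_covering_space[OF uc] e]
    by (auto simp: loops_def)
  with \<alpha> show ?thesis by (rule that)
qed

lemma canonical_map_hom: "canonical_map E q e \<in> hom (fundamental_group B (q e)) (deck_group E q)"
proof (rule homI)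
  fix c assume "c \<in> carrier (fundamental_group B (q e))"
  then show "canonical_map E q e c \<in> carrier (deck_group E q)"
    by (metis fundamental_group_representative canonical_map_loop_class(1)[OF uc]
        carrier_deck_group)
next
  let ?T = "canonical_map E q e" and ?P = "fundamental_group B (q e)"
  fix c d assume "c \<in> carrier ?P" "d \<in> carrier ?P"
  then obtain \<alpha> \<gamma> \<beta> \<delta> where
    \<alpha>: "\<alpha> \<in> loops B (q e)" "c = loop_class B \<alpha>" and \<gamma>: "path_lift E q e \<alpha> \<gamma>" and
    \<beta>: "\<beta> \<in> loops B (q e)" "d = loop_class B \<beta>" and \<delta>: "path_lift E q e \<beta> \<delta>"
    by (metis fundamental_group_representative)
  have c: "?T c \<in> deck_transformations E q" "?T c e = pathfinish \<gamma>"
    using canonical_map_loop_class[OF uc \<alpha>(1) \<gamma>] \<alpha>(2) by simp_all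
  have d: "?T d \<in> deck_transformations E q" "?T d e = pathfinish \<delta>"
    using canonical_map_loop_class[OF uc \<beta>(1) \<delta>] \<beta>(2) by simp_all
  note cd = canonical_map_loop_class[OF uc loops_join[OF \<alpha>(1) \<beta>(1)]
      path_lift_join_deck_transformation[OF \<gamma> \<delta> c]]
  have "?T (loop_class B (\<alpha> +++ \<beta>)) = compose E (?T c) (?T d)"
    by (rule deck_transformation_eqI[OF uc e cd(1) deck_transformation_compose[OF c(1) d(1)]])
      (use cd(2) d(2) e in \<open>simp add: compose_def pathfinish_compose\<close>)
  then show "?T (c \<otimes>\<^bsub>?P\<^esub> d) = ?T c \<otimes>\<^bsub>deck_group E q\<^esub> ?T d"
    using \<alpha> \<beta> c(1) d(1) by (simp add: mult_fundamental_group mult_deck_group)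
qed

lemma canonical_map_eq_oneD:
  assumes "c \<in> carrier (fundamental_group B (q e))"
    and "canonical_map E q e c = \<one>\<^bsub>deck_group E q\<^esub>"
  shows "c = \<one>\<^bsub>fundamental_group B (q e)\<^esub>"
proof -
  obtain \<alpha> \<gamma> where \<alpha>: "\<alpha> \<in> loops B (q e)" "c = loop_class B \<alpha>" and \<gamma>: "path_lift E q e \<alpha> \<gamma>"
    using assms(1) by (rule fundamental_group_representative)
  have "pathfinish \<gamma> = e"
    using canonical_map_loop_class(2)[OF uc \<alpha>(1) \<gamma>] \<alpha>(2) assms(2) e by (simp add: one_deck_group)
  then have "homotopic_paths E \<gamma> (\<lambda>_. e)"
    using uc \<gamma> by (intro simply_connected_imp_loops_null_homotopic)
      (auto simp: universal_covering_def path_lift_def loops_def)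
  moreover have "q \<in> E \<rightarrow> B" using universal_covering_imp_surjective[OF uc] by blast
  ultimately have "homotopic_paths B (q \<circ> \<gamma>) (q \<circ> (\<lambda>_. e))"
    using universal_covering_imp_continuous[OF uc] homotopic_paths_continuous_image by blast
  moreover have "homotopic_paths B \<alpha> (q \<circ> \<gamma>)"
    using \<alpha>(1) \<gamma> by (intro homotopic_paths_eq) (auto simp: loops_def path_lift_def)
  ultimately have "homotopic_paths B \<alpha> (\<lambda>_. q e)" unfolding o_def by (metis homotopic_paths_trans)
  then show ?thesis using \<alpha>(2) by (simp add: one_fundamental_group loop_class_eqI)
qed

lemma deck_transformation_in_canonical_map_image:
  assumes h: "h \<in> deck_transformations E q"
  shows "h \<in> canonical_map E q e ` carrier (fundamental_group B (q e))"
proof -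
  note q = universal_covering_imp_continuous[OF uc] universal_covering_imp_surjective[OF uc]
  obtain \<gamma> where \<gamma>: "path \<gamma>" "path_image \<gamma> \<subseteq> E" "pathstart \<gamma> = e" "pathfinish \<gamma> = h e"
    using universal_covering_imp_path_connected[OF uc] e deck_transformationD(2)[OF h e]
    unfolding path_connected_def by metis
  have loop: "q \<circ> \<gamma> \<in> loops B (q e)"
    using \<gamma> q deck_transformationD(3)[OF h e]
    by (auto simp: loops_def path_image_compose pathstart_compose pathfinish_compose
        intro: path_continuous_image continuous_on_subset)
  have "path_lift E q e (q \<circ> \<gamma>) \<gamma>" using \<gamma> by (simp add: path_lift_def)
  note T = canonical_map_loop_class[OF uc loop this]
  have "canonical_map E q e (loop_class B (q \<circ> \<gamma>)) = h"
    by (rule deck_transformation_eqI[OF uc e T(1) h]) (use T(2) \<gamma>(4) in simp)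
  then show ?thesis using loop by (auto simp: carrier_fundamental_group)
qed

theorem canonical_map_iso: "canonical_map E q e \<in> iso (fundamental_group B (q e)) (deck_group E q)"
proof -
  have "q e \<in> B" using e universal_covering_imp_surjective[OF uc] by blast
  then interpret group_hom "fundamental_group B (q e)" "deck_group E q" "canonical_map E q e"
    by (intro group_hom.intro group_hom_axioms.intro
        group_fundamental_group group_deck_group canonical_map_hom)
  show ?thesis
    unfolding iso_iff
    using deck_transformation_in_canonical_map_image canonical_map_eq_oneD by auto
qed

end

subsection \<open>Gottlieb groups\<close>

definition homotopy_between ::
  "'x::topological_space set \<Rightarrow> 'y::topological_space set \<Rightarrow> ('x \<Rightarrow> 'y) \<Rightarrow> ('x \<Rightarrow> 'y) \<Rightarrow>
   ('x \<times> real \<Rightarrow> 'y) \<Rightarrow> bool" where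
  "homotopy_between X Y f g H \<longleftrightarrow> continuous_on (X \<times> {0..1}) H \<and> H \<in> X \<times> {0..1} \<rightarrow> Y \<and>
     (\<forall>x\<in>X. H (x, 0) = f x \<and> H (x, 1) = g x)"

definition homotopy_join ::
  "('x \<times> real \<Rightarrow> 'y::topological_space) \<Rightarrow> ('x \<times> real \<Rightarrow> 'y) \<Rightarrow> 'x \<times> real \<Rightarrow> 'y" where
  "homotopy_join P Q = (\<lambda>(x, t). (curry P x +++ curry Q x) t)"

definition homotopy_reverse :: "('x \<times> real \<Rightarrow> 'y::topological_space) \<Rightarrow> 'x \<times> real \<Rightarrow> 'y" where
  "homotopy_reverse P = (\<lambda>(x, t). reversepath (curry P x) t)"

lemma curry_homotopy_join: "curry (homotopy_join P Q) x = curry P x +++ curry Q x"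
  by (simp add: homotopy_join_def fun_eq_iff)

lemma curry_homotopy_reverse: "curry (homotopy_reverse P) x = reversepath (curry P x)"
  by (simp add: homotopy_reverse_def fun_eq_iff)

lemma homotopy_between_const:
  assumes "continuous_on X f" "f \<in> X \<rightarrow> Y"
  shows "homotopy_between X Y f f (\<lambda>(x, t). f x)"
proof -
  have "continuous_on (X \<times> {0..1::real}) (\<lambda>w. f (fst w))"
    by (rule continuous_on_compose2[OF assms(1)]) (auto intro!: continuous_intros)
  then show ?thesis using assms(2) by (auto simp: homotopy_between_def case_prod_beta)
qed

lemma homotopy_between_reverse:
  assumes "homotopy_between X Y f g P"
  shows "homotopy_between X Y g f (homotopy_reverse P)"
proof -
  have "continuous_on (X \<times> {0..1}) (\<lambda>w. P (fst w, 1 - snd w))"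
    by (rule continuous_on_compose2[of "X \<times> {0..1}" P])
      (use assms in \<open>auto simp: homotopy_between_def intro!: continuous_intros\<close>)
  then show ?thesis
    using assms
    by (auto simp: homotopy_between_def homotopy_reverse_def reversepath_def case_prod_beta)
qed

lemma homotopy_between_join:
  assumes "homotopy_between X Y f g P" "homotopy_between X Y g h Q"
  shows "homotopy_between X Y f h (homotopy_join P Q)"
proof -
  have P: "continuous_on (X \<times> {0..1}) P" and Q: "continuous_on (X \<times> {0..1}) Q"
    and meet: "\<And>x. x \<in> X \<Longrightarrow> P (x, 1) = Q (x, 0)"
    using assms by (auto simp: homotopy_between_def)
  have "continuous_on (X \<times> {0..1})
      (\<lambda>w. if snd w \<le> 1/2 then P (fst w, 2 * snd w) else Q (fst w, 2 * snd w - 1))"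
  proof (rule continuous_on_cases_le)
    show "continuous_on {w \<in> X \<times> {0..1}. snd w \<le> 1/2} (\<lambda>w. P (fst w, 2 * snd w))"
      by (rule continuous_on_compose2[OF P]) (auto intro!: continuous_intros)
    show "continuous_on {w \<in> X \<times> {0..1}. 1/2 \<le> snd w} (\<lambda>w. Q (fst w, 2 * snd w - 1))"
      by (rule continuous_on_compose2[OF Q]) (auto intro!: continuous_intros)
    show "P (fst w, 2 * snd w) = Q (fst w, 2 * snd w - 1)" if "w \<in> X \<times> {0..1}" "snd w = 1/2" for w
    proof -
      have "2 * snd w = 1" "fst w \<in> X" using that by auto
      then show ?thesis using meet by (simp only:) simp
    qed
  qed (auto intro!: continuous_intros)
  moreover have "homotopy_join P Q =
      (\<lambda>w. if snd w \<le> 1/2 then P (fst w, 2 * snd w) else Q (fst w, 2 * snd w - 1))"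
    by (auto simp: homotopy_join_def joinpaths_def)
  moreover have "P v \<in> Y" "Q v \<in> Y" if "v \<in> X \<times> {0..1}" for v
    using assms that by (auto simp: homotopy_between_def)
  then have "homotopy_join P Q \<in> X \<times> {0..1} \<rightarrow> Y"
    by (auto simp: homotopy_join_def joinpaths_def)
  moreover have "homotopy_join P Q (x, 0) = f x" "homotopy_join P Q (x, 1) = h x" if "x \<in> X" for x
    using assms that by (simp_all add: homotopy_between_def homotopy_join_def joinpaths_def)
  ultimately show ?thesis by (simp add: homotopy_between_def)
qed

lemma homotopy_between_loop:
  assumes "homotopy_between X Y f f H" "x \<in> X"
  shows "curry H x \<in> loops Y (f x)"
  using assms continuous_on_o_Pair[of X "{0..1}" H x]
  by (auto simp: homotopy_between_def loops_def path_def path_image_def pathstart_def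
      pathfinish_def curry_def o_def)

lemma sphere_cis_image: "sphere 0 1 = (\<lambda>t. cis (2 * pi * t)) ` {0..1}"
proof (intro equalityI subsetI)
  fix z :: complex assume "z \<in> sphere 0 1"
  then have "z = cis (2 * pi * (Arg2pi z / (2 * pi)))"
    using complex_norm_eq_1_exp[of z] by (simp add: cis_conv_exp)
  moreover have "Arg2pi z / (2 * pi) \<in> {0..1}"
    using Arg2pi_ge_0[of z] Arg2pi_lt_2pi[of z] by (simp add: field_simps)
  ultimately show "z \<in> (\<lambda>t. cis (2 * pi * t)) ` {0..1}" by blast
qed auto

lemma cis_2pi_eq_iff:
  assumes "s \<in> {0..1}" "t \<in> {0..1}"
  shows "cis (2 * pi * s) = cis (2 * pi * t) \<longleftrightarrow> s = t \<or> s = 0 \<and> t = 1 \<or> s = 1 \<and> t = 0"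
proof
  assume "cis (2 * pi * s) = cis (2 * pi * t)"
  then obtain n :: int where "2 * pi * s = 2 * pi * t + 2 * of_int n * pi"
    unfolding cis_conv_exp exp_eq by (auto simp: complex_eq_iff)
  then have "2 * pi * s = 2 * pi * (t + of_int n)" by (simp add: algebra_simps)
  then have "s = t + of_int n" by simp
  moreover from this have "n \<in> {-1, 0, 1}" using assms by auto
  ultimately show "s = t \<or> s = 0 \<and> t = 1 \<or> s = 1 \<and> t = 0" using assms by auto
qed auto

lemma quotient_map_times_circle:
  "quotient_map (top_of_set (X \<times> {0..1})) (top_of_set (X \<times> sphere 0 1))
     (map_prod id (\<lambda>t. cis (2 * pi * t)))"
    (is "quotient_map ?S ?T ?e")
proof (rule continuous_closed_imp_quotient_map)
  let ?I = "top_of_set {0..1::real}" and ?C = "top_of_set (sphere 0 (1::real)) :: complex topology"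
  have "continuous_map ?I ?C (\<lambda>t. cis (2 * pi * t))"
    by (auto simp: continuous_map_in_subtopology intro!: continuous_intros)
  then have "proper_map ?I ?C (\<lambda>t. cis (2 * pi * t))"
    by (intro continuous_imp_proper_map)
      (auto simp: compact_space_subtopology Hausdorff_imp_kc_space Hausdorff_space_subtopology)
  then have "proper_map (prod_topology (top_of_set X) ?I) (prod_topology (top_of_set X) ?C) ?e"
    using proper_map_id[of "top_of_set X"] unfolding map_prod_def proper_map_prod id_def by blast
  then show "closed_map ?S ?T ?e"
    by (intro proper_imp_closed_map) (simp add: prod_topology_subtopology_eu)
  have "continuous_on (X \<times> {0..1}) ?e"
    by (auto simp: map_prod_def case_prod_beta intro!: continuous_intros)
  then show "continuous_map ?S ?T ?e" by (auto simp: continuous_map_in_subtopology)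
  show "?e ` topspace ?S = topspace ?T"
    by (simp add: map_prod_surj_on[OF _ sphere_cis_image[symmetric]])
qed

lemma quotient_map_descent:
  assumes "quotient_map (top_of_set S) (top_of_set T) e"
    and h: "continuous_on S h" "h \<in> S \<rightarrow> Y"
    and "\<And>v w. \<lbrakk>v \<in> S; w \<in> S; e v = e w\<rbrakk> \<Longrightarrow> h v = h w"
  obtains F where "continuous_on T F" "F \<in> T \<rightarrow> Y" "\<forall>w\<in>S. F (e w) = h w"
proof (rule quotient_map_lift_exists[OF assms(1), of "top_of_set Y" h])
  show "continuous_map (top_of_set S) (top_of_set Y) h"
    using h by (auto simp: continuous_map_in_subtopology)
  show "h v = h w"
    if "v \<in> topspace (top_of_set S)" "w \<in> topspace (top_of_set S)" "e v = e w" for v w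
    using that by (intro assms(4)) simp_all
  fix F assume F: "continuous_map (top_of_set T) (top_of_set Y) F"
    and descends: "\<And>w. w \<in> topspace (top_of_set S) \<Longrightarrow> F (e w) = h w"
  have "continuous_on T F" "F \<in> T \<rightarrow> Y" using F by (auto simp: continuous_map_in_subtopology)
  moreover have "\<forall>w\<in>S. F (e w) = h w" using descends by simp
  ultimately show ?thesis by (rule that)
qed

lemma homotopy_between_circle_map:
  assumes "continuous_on (X \<times> sphere 0 1) F" "F \<in> X \<times> sphere 0 1 \<rightarrow> Y"
  shows "homotopy_between X Y (\<lambda>x. F (x, 1)) (\<lambda>x. F (x, 1)) (\<lambda>(x, t). F (x, cis (2 * pi * t)))"
proof -
  have "continuous_on (X \<times> {0..1}) (\<lambda>w. F (fst w, cis (2 * pi * snd w)))"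
    by (rule continuous_on_compose2[OF assms(1)]) (auto intro!: continuous_intros)
  then show ?thesis using assms(2) by (auto simp: homotopy_between_def case_prod_beta)
qed

lemma homotopy_between_on_circle:
  assumes H: "homotopy_between X Y f f H"
  obtains F where "continuous_on (X \<times> sphere 0 1) F" "F \<in> X \<times> sphere 0 1 \<rightarrow> Y"
    "\<And>x t. \<lbrakk>x \<in> X; t \<in> {0..1}\<rbrakk> \<Longrightarrow> F (x, cis (2 * pi * t)) = H (x, t)"
proof -
  let ?e = "map_prod id (\<lambda>t. cis (2 * pi * t)) :: 'a \<times> real \<Rightarrow> 'a \<times> complex"
  have "continuous_on (X \<times> {0..1}) H" "H \<in> X \<times> {0..1} \<rightarrow> Y"
    using H by (simp_all add: homotopy_between_def)
  moreover have "H v = H w" if "v \<in> X \<times> {0..1}" "w \<in> X \<times> {0..1}" "?e v = ?e w" for v w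
    using that H by (auto simp: cis_2pi_eq_iff homotopy_between_def)
  ultimately obtain F where F: "continuous_on (X \<times> sphere 0 1) F" "F \<in> X \<times> sphere 0 1 \<rightarrow> Y"
    and descends: "\<forall>w\<in>X \<times> {0..1}. F (?e w) = H w"
    by (rule quotient_map_descent[OF quotient_map_times_circle])
  have "F (x, cis (2 * pi * t)) = H (x, t)" if "x \<in> X" "t \<in> {0..1}" for x t
    using bspec[OF descends, of "(x, t)"] that by simp
  with F show ?thesis by (rule that)
qed

lemma loop_class_cyclic_homotopy_in_gottlieb_group:
  assumes H: "homotopy_between X Y f f H" and x0: "x0 \<in> X"
  shows "loop_class Y (curry H x0) \<in> gottlieb_group X Y f x0"
proof -
  obtain F where F: "continuous_on (X \<times> sphere 0 1) F" "F \<in> X \<times> sphere 0 1 \<rightarrow> Y"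
    and FH: "\<And>x t. \<lbrakk>x \<in> X; t \<in> {0..1}\<rbrakk> \<Longrightarrow> F (x, cis (2 * pi * t)) = H (x, t)"
    by (rule homotopy_between_on_circle[OF H]) blast
  define a where "a z = F (x0, z)" for z
  have F1: "F (x, 1) = f x" if "x \<in> X" for x
    using FH[of x 0] H that by (simp add: homotopy_between_def)
  have loop: "curry H x0 \<in> loops Y (f x0)" by (rule homotopy_between_loop[OF H x0])
  have "continuous_on (sphere 0 1) a"
    unfolding a_def
    by (rule continuous_on_compose2[OF F(1)]) (use x0 in \<open>auto intro!: continuous_intros\<close>)
  moreover have "a \<in> sphere 0 1 \<rightarrow> Y" "a 1 = f x0" using F(2) F1 x0 by (auto simp: a_def)
  moreover have "loop_class Y (curry H x0) = loop_class Y (\<lambda>t. a (cis (2 * pi * t)))"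
    using loop FH[OF x0] by (intro loop_class_eqI homotopic_paths_eq) (auto simp: loops_def a_def)
  moreover have "homotopic_with_canon (\<lambda>_. True) (wedge_circle X x0) Y F (wedge_map f a)"
  proof (rule homotopic_with_equal)
    have "wedge_circle X x0 \<subseteq> X \<times> sphere 0 1" using x0 by (auto simp: wedge_circle_def)
    then show "continuous_map (top_of_set (wedge_circle X x0)) (top_of_set Y) F"
      using continuous_on_subset[OF F(1)] F(2) by (auto simp: continuous_map_in_subtopology)
    show "F w = wedge_map f a w" if "w \<in> topspace (top_of_set (wedge_circle X x0))" for w
      using that F1 x0 by (auto simp: wedge_circle_def wedge_map_def a_def)
  qed auto
  moreover have "loop_class Y (curry H x0) \<in> carrier (fundamental_group Y (f x0))"
    using loop by (simp add: carrier_fundamental_group)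
  ultimately show ?thesis using F unfolding gottlieb_group_def by blast
qed

lemma homotopic_paths_circle_homotopy:
  assumes "continuous_on ({0..1} \<times> sphere 0 1) u" "u \<in> {0..1::real} \<times> sphere 0 1 \<rightarrow> S"
  shows "homotopic_paths S (\<lambda>t. u (0, cis (2 * pi * t)))
           ((\<lambda>s. u (s, 1)) +++ ((\<lambda>t. u (1, cis (2 * pi * t))) +++ reversepath (\<lambda>s. u (s, 1))))"
proof -
  let ?v = "\<lambda>w. u (fst w, cis (2 * pi * snd w))"
  have "continuous_on ({0..1} \<times> {0..1}) ?v"
    by (rule continuous_on_compose2[OF assms(1)]) (auto intro!: continuous_intros)
  moreover have "?v \<in> {0..1} \<times> {0..1} \<rightarrow> S" using assms(2) by auto
  ultimately show ?thesis using homotopic_paths_square[of ?v S] by simp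
qed

text \<open>The homotopy from \<open>f \<or> a\<close> to \<open>F\<close> need not fix \<open>X \<times> {1}\<close>, so \<open>F\<close> is conjugated by the
  restriction of that homotopy to \<open>X \<times> {1}\<close>. Its restriction to the circle at \<open>x\<^sub>0\<close> shows that the
  class of the loop is unchanged.\<close>

lemma wedge_homotopy_imp_cyclic_homotopy:
  assumes F: "continuous_on (X \<times> sphere 0 1) F" "F \<in> X \<times> sphere 0 1 \<rightarrow> Y"
    and a: "a 1 = f x0"
    and k: "continuous_on ({0..1} \<times> wedge_circle X x0) k" "k \<in> {0..1::real} \<times> wedge_circle X x0 \<rightarrow> Y"
    and k0: "\<And>w. k (0, w) = wedge_map f a w" and k1: "\<And>w. k (1, w) = F w"
  obtains H where "homotopy_between X Y f f H"
    "homotopic_paths Y (\<lambda>t. a (cis (2 * pi * t))) (curry H x0)"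
proof -
  define K where "K = (\<lambda>(x, s). k (s, (x, 1)))"
  define L where "L = (\<lambda>(x, t). F (x, cis (2 * pi * t)))"
  let ?H = "homotopy_join K (homotopy_join L (homotopy_reverse K))"
  have K: "homotopy_between X Y f (\<lambda>x. F (x, 1)) K"
  proof -
    have "continuous_on (X \<times> {0..1}) (\<lambda>w. k (snd w, (fst w, 1)))"
      by (rule continuous_on_compose2[OF k(1)])
        (auto simp: wedge_circle_def intro!: continuous_intros)
    then show ?thesis
      using k(2) k0 k1
      by (auto simp: homotopy_between_def K_def wedge_circle_def wedge_map_def case_prod_beta)
  qed
  have L: "homotopy_between X Y (\<lambda>x. F (x, 1)) (\<lambda>x. F (x, 1)) L"
    unfolding L_def using F by (rule homotopy_between_circle_map)
  have "homotopy_between X Y f f ?H"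
    using K L by (intro homotopy_between_join homotopy_between_reverse)
  moreover have "homotopic_paths Y (\<lambda>t. a (cis (2 * pi * t))) (curry ?H x0)"
  proof -
    let ?u = "\<lambda>w. k (fst w, (x0, snd w))"
    have "continuous_on ({0..1} \<times> sphere 0 1) ?u"
      by (rule continuous_on_compose2[OF k(1)])
        (auto simp: wedge_circle_def intro!: continuous_intros)
    moreover have "?u \<in> {0..1} \<times> sphere 0 1 \<rightarrow> Y" using k(2) by (auto simp: wedge_circle_def)
    moreover have "(\<lambda>t. a (cis (2 * pi * t))) = (\<lambda>t. ?u (0, cis (2 * pi * t)))"
      using a by (auto simp: k0 wedge_map_def)
    moreover have "curry K x0 = (\<lambda>s. ?u (s, 1))" "curry L x0 = (\<lambda>t. ?u (1, cis (2 * pi * t)))"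
      by (simp_all add: K_def L_def k1 fun_eq_iff)
    ultimately show ?thesis
      using homotopic_paths_circle_homotopy[of ?u Y]
      by (simp only: curry_homotopy_join curry_homotopy_reverse)
  qed
  ultimately show ?thesis by (rule that)
qed

lemma gottlieb_groupE:
  assumes "c \<in> gottlieb_group X Y f x0"
  obtains H where "homotopy_between X Y f f H" "c = loop_class Y (curry H x0)"
proof -
  obtain a F where a: "a 1 = f x0" and c: "c = loop_class Y (\<lambda>t. a (cis (2 * pi * t)))"
    and F: "continuous_on (X \<times> sphere 0 1) F" "F \<in> X \<times> sphere 0 1 \<rightarrow> Y"
    and F_wedge: "homotopic_with_canon (\<lambda>_. True) (wedge_circle X x0) Y F (wedge_map f a)"
    using assms unfolding gottlieb_group_def by blast
  obtain k where k: "continuous_on ({0..1} \<times> wedge_circle X x0) k"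
    "k \<in> {0..1::real} \<times> wedge_circle X x0 \<rightarrow> Y"
    and "\<And>w. k (0, w) = wedge_map f a w" "\<And>w. k (1, w) = F w"
    using homotopic_with_symD[OF F_wedge] unfolding homotopic_with_def
    by (auto simp: continuous_map_in_subtopology image_subset_iff)
  with F a obtain H where "homotopy_between X Y f f H"
    and "homotopic_paths Y (\<lambda>t. a (cis (2 * pi * t))) (curry H x0)"
    using wedge_homotopy_imp_cyclic_homotopy by blast
  then show ?thesis using c loop_class_eqI by (intro that) auto
qed

lemma gottlieb_group_eq:
  assumes "x0 \<in> X"
  shows "gottlieb_group X Y f x0 =
    (\<lambda>H. loop_class Y (curry H x0)) ` {H. homotopy_between X Y f f H}"
  using assms loop_class_cyclic_homotopy_in_gottlieb_group by (blast elim: gottlieb_groupE)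

theorem subgroup_gottlieb_group:
  assumes f: "continuous_on X f" "f \<in> X \<rightarrow> Y" and x0: "x0 \<in> X"
  shows "subgroup (gottlieb_group X Y f x0) (fundamental_group Y (f x0))"
proof -
  have y: "f x0 \<in> Y" using f(2) x0 by blast
  show ?thesis
    unfolding gottlieb_group_eq[OF x0]
  proof (rule group.subgroupI[OF group_fundamental_group[OF y]]; clarsimp)
    fix H assume "homotopy_between X Y f f H"
    then show "loop_class Y (curry H x0) \<in> carrier (fundamental_group Y (f x0))"
      using homotopy_between_loop[of X Y f H x0] x0 by (simp add: carrier_fundamental_group)
  next
    show "\<exists>H. homotopy_between X Y f f H" using homotopy_between_const[OF f] by blast
  next
    fix H assume H: "homotopy_between X Y f f H"
    then have "inv\<^bsub>fundamental_group Y (f x0)\<^esub> loop_class Y (curry H x0) =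
        loop_class Y (curry (homotopy_reverse H) x0)"
      using homotopy_between_loop[OF H x0]
      by (simp add: inv_fundamental_group[OF y] curry_homotopy_reverse)
    then show "inv\<^bsub>fundamental_group Y (f x0)\<^esub> loop_class Y (curry H x0) \<in>
        (\<lambda>H. loop_class Y (curry H x0)) ` {H. homotopy_between X Y f f H}"
      using homotopy_between_reverse[OF H] by blast
  next
    fix P Q assume P: "homotopy_between X Y f f P" and Q: "homotopy_between X Y f f Q"
    have "loop_class Y (curry P x0) \<otimes>\<^bsub>fundamental_group Y (f x0)\<^esub> loop_class Y (curry Q x0) =
        loop_class Y (curry (homotopy_join P Q) x0)"
      using homotopy_between_loop[OF P x0] homotopy_between_loop[OF Q x0]
      by (simp add: mult_fundamental_group curry_homotopy_join)
    then show "loop_class Y (curry P x0) \<otimes>\<^bsub>fundamental_group Y (f x0)\<^esub> loop_class Y (curry Q x0) \<in>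
        (\<lambda>H. loop_class Y (curry H x0)) ` {H. homotopy_between X Y f f H}"
      using homotopy_between_join[OF P Q] by blast
  qed
qed

subsection \<open>Fibre-preserving homotopies\<close>

lemma quotient_map_covering_times_interval:
  assumes "covering_space D p X"
  shows "quotient_map (top_of_set (D \<times> {0..1::real})) (top_of_set (X \<times> {0..1})) (map_prod p id)"
proof -
  have "continuous_on D p" "p ` D = X" using assms by (auto simp: covering_space_def)
  then have "quotient_map (top_of_set D) (top_of_set X) p"
    using covering_space_imp_open_map[OF assms]
    by (intro continuous_open_imp_quotient_map) (auto simp: continuous_map_in_subtopology)
  then have "quotient_map (prod_topology (top_of_set D) (top_of_set {0..1::real}))
      (prod_topology (top_of_set X) (top_of_set {0..1})) (\<lambda>(x, t). (p x, t))"
    by (intro quotient_map_prod_left)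
      (auto simp: Hausdorff_space_subtopology compact_imp_locally_compact_space
        compact_space_subtopology)
  then show ?thesis by (simp add: map_prod_def id_def)
qed

lemma lifting_of_imp_fibre_preserving_homotopy:
  "lifting_of (D \<times> {0..1}) (map_prod p id) E q H K \<Longrightarrow> fibre_preserving_homotopy D p E q K"
  by (simp add: lifting_of_def fibre_preserving_homotopy_def)

lemma fibre_preserving_homotopy_descends:
  assumes covX: "covering_space D p X" and covY: "covering_space E q Y"
    and K: "fibre_preserving_homotopy D p E q K"
  obtains H where "continuous_on (X \<times> {0..1}) H" "H \<in> X \<times> {0..1} \<rightarrow> Y"
    "lifting_of (D \<times> {0..1}) (map_prod p id) E q H K"
proof -
  have K_cont: "continuous_on (D \<times> {0..1}) K" and K_into: "K \<in> D \<times> {0..1} \<rightarrow> E"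
    using K by (auto simp: fibre_preserving_homotopy_def)
  have q: "continuous_on E q" "q ` E = Y" using covY by (auto simp: covering_space_def)
  have "continuous_on (D \<times> {0..1}) (\<lambda>w. q (K w))"
    by (rule continuous_on_compose2[OF q(1) K_cont]) (use K_into in auto)
  moreover have "(\<lambda>w. q (K w)) \<in> D \<times> {0..1} \<rightarrow> Y" using K_into q(2) by auto
  moreover have "q (K v) = q (K w)"
    if "v \<in> D \<times> {0..1}" "w \<in> D \<times> {0..1}" "map_prod p id v = map_prod p id w" for v w
  proof -
    have "p (fst v) = p (fst w)" "snd v = snd w" using that(3) by (simp_all add: prod_eq_iff)
    then have "q (K (fst v, snd v)) = q (K (fst w, snd w))"
      using K that(1,2) by (simp add: fibre_preserving_homotopy_def mem_Times_iff)
    then show ?thesis by simp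
  qed
  ultimately obtain H where H: "continuous_on (X \<times> {0..1}) H" "H \<in> X \<times> {0..1} \<rightarrow> Y"
    and descends: "\<forall>w\<in>D \<times> {0..1}. H (map_prod p id w) = q (K w)"
    by (rule quotient_map_descent[OF quotient_map_covering_times_interval[OF covX]])
  have "lifting_of (D \<times> {0..1}) (map_prod p id) E q H K"
    using K_cont K_into descends unfolding lifting_of_def by simp
  with H show ?thesis by (rule that)
qed

context
  fixes D :: "'d::topological_space set" and p :: "'d \<Rightarrow> 'x::topological_space" and X :: "'x set"
    and E :: "'e::topological_space set" and q :: "'e \<Rightarrow> 'y::topological_space" and Y :: "'y set"
    and f :: "'x \<Rightarrow> 'y" and g :: "'d \<Rightarrow> 'e" and x :: 'd
  assumes ucX: "universal_covering D p X" and ucY: "universal_covering E q Y"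
    and g: "lifting_of D p E q f g" and x: "x \<in> D"
begin

lemma cyclic_homotopy_lift_exists:
  assumes H: "homotopy_between X Y f f H"
  obtains K where "lifting_of (D \<times> {0..1}) (map_prod p id) E q H K" "\<And>z. z \<in> D \<Longrightarrow> K (z, 0) = g z"
proof -
  let ?H = "\<lambda>w. H (p (fst w), snd w)"
  note p = universal_covering_imp_continuous[OF ucX] universal_covering_imp_surjective[OF ucX]
  have "continuous_on (D \<times> {0..1}) (\<lambda>w. (p (fst w), snd w))"
    by (intro continuous_intros continuous_on_compose2[OF p(1)]) auto
  then have "continuous_on (D \<times> {0..1}) ?H"
    by (rule continuous_on_compose2[of "X \<times> {0..1}" H, rotated])
      (use H p(2) in \<open>auto simp: homotopy_between_def\<close>)
  moreover have "?H \<in> D \<times> {0..1} \<rightarrow> Y" using H p(2) by (auto simp: homotopy_between_def)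
  moreover have "lifting_of D (\<lambda>z. (z, 0)) E q ?H g"
    using g H p(2) by (auto simp: lifting_of_def homotopy_between_def)
  ultimately obtain K where "lifting_of (D \<times> {0..1}) id E q ?H K" "\<And>z. z \<in> D \<Longrightarrow> K (z, 0) = g z"
    by (rule covering_homotopy_lifting[OF universal_covering_imp_covering_space[OF ucY]]) blast
  then show ?thesis by (intro that[of K]) (simp_all add: lifting_of_def)
qed

lemma canonical_map_cyclic_homotopy:
  assumes H: "homotopy_between X Y f f H"
    and K: "lifting_of (D \<times> {0..1}) (map_prod p id) E q H K" "\<And>z. z \<in> D \<Longrightarrow> K (z, 0) = g z"
  shows "canonical_map E q (g x) (loop_class Y (curry H (p x))) \<in> deck_transformations E q"
    and "canonical_map E q (g x) (loop_class Y (curry H (p x))) (g x) = K (x, 1)"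
proof -
  have "p x \<in> X" using universal_covering_imp_surjective[OF ucX] x by blast
  then have "curry H (p x) \<in> loops Y (q (g x))"
    using homotopy_between_loop[OF H] g x by (simp add: lifting_of_def)
  moreover have "path_lift E q (g x) (curry H (p x)) (\<lambda>t. K (x, t))"
    using lifting_of_track[OF K(1) x] K(2)[OF x]
    by (simp add: path_lift_iff_lifting_of lifting_of_def)
  ultimately show
    "canonical_map E q (g x) (loop_class Y (curry H (p x))) \<in> deck_transformations E q"
    and "canonical_map E q (g x) (loop_class Y (curry H (p x))) (g x) = K (x, 1)"
    using canonical_map_loop_class[OF ucY] by (auto simp: pathfinish_def)
qed

lemma lifted_cyclic_homotopy_end:
  assumes H: "homotopy_between X Y f f H"
    and K: "lifting_of (D \<times> {0..1}) (map_prod p id) E q H K"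
    and h: "h \<in> deck_transformations E q" "h (g x) = K (x, 1)" and z: "z \<in> D"
  shows "K (z, 1) = h (g z)"
proof (rule lifting_of_unique[OF universal_covering_imp_covering_space[OF ucY],
      where ?g1.0 = "\<lambda>z. K (z, 1)" and ?g2.0 = "\<lambda>z. h (g z)"])
  show "connected D"
    by (rule path_connected_imp_connected[OF universal_covering_imp_path_connected[OF ucX]])
  have "continuous_on D (\<lambda>z. h (g z))"
    by (rule continuous_on_compose2[OF deck_transformationD(1)[OF h(1)]])
      (use g in \<open>auto simp: lifting_of_def\<close>)
  then show "lifting_of D p E q f (\<lambda>z. h (g z))"
    using g deck_transformationD(2,3)[OF h(1)] by (auto simp: lifting_of_def Pi_iff)
  show "lifting_of D p E q f (\<lambda>z. K (z, 1))"
    using lifting_of_slice[OF K, of 1] H universal_covering_imp_surjective[OF ucX]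
    by (auto simp: lifting_of_def homotopy_between_def)
qed (use x z h(2)[symmetric] in simp_all)

lemma canonical_map_image_gottlieb_group_subset:
  "canonical_map E q (g x) ` gottlieb_group X Y f (p x) \<subseteq> deck_gottlieb D p E q g"
proof
  fix h assume "h \<in> canonical_map E q (g x) ` gottlieb_group X Y f (p x)"
  moreover have "p x \<in> X" using universal_covering_imp_surjective[OF ucX] x by blast
  ultimately obtain H where H: "homotopy_between X Y f f H"
    and h: "h = canonical_map E q (g x) (loop_class Y (curry H (p x)))"
    by (auto simp: gottlieb_group_eq)
  obtain K where K: "lifting_of (D \<times> {0..1}) (map_prod p id) E q H K" "\<And>z. z \<in> D \<Longrightarrow> K (z, 0) = g z"
    by (rule cyclic_homotopy_lift_exists[OF H]) blast
  have deck: "h \<in> deck_transformations E q" "h (g x) = K (x, 1)"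
    unfolding h by (rule canonical_map_cyclic_homotopy[OF H K]; assumption)+
  then have "K (z, 1) = h (g z)" if "z \<in> D" for z
    using lifted_cyclic_homotopy_end[OF H K(1)] that by blast
  then show "h \<in> deck_gottlieb D p E q g"
    using deck(1) K(2) lifting_of_imp_fibre_preserving_homotopy[OF K(1)]
    unfolding deck_gottlieb_def by blast
qed

lemma deck_gottlieb_subset_canonical_map_image:
  "deck_gottlieb D p E q g \<subseteq> canonical_map E q (g x) ` gottlieb_group X Y f (p x)"
proof
  let ?T = "canonical_map E q (g x)"
  fix h assume "h \<in> deck_gottlieb D p E q g"
  then obtain K where h: "h \<in> deck_transformations E q" and K: "fibre_preserving_homotopy D p E q K"
    and K0: "\<And>z. z \<in> D \<Longrightarrow> K (z, 0) = g z" and K1: "\<And>z. z \<in> D \<Longrightarrow> K (z, 1) = h (g z)"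
    unfolding deck_gottlieb_def by blast
  obtain H where H: "continuous_on (X \<times> {0..1}) H" "H \<in> X \<times> {0..1} \<rightarrow> Y"
    and lift: "lifting_of (D \<times> {0..1}) (map_prod p id) E q H K"
    by (rule fibre_preserving_homotopy_descends[OF universal_covering_imp_covering_space[OF ucX]
          universal_covering_imp_covering_space[OF ucY] K])
  note X = universal_covering_imp_surjective[OF ucX, symmetric]
  have "H (p z, 0) = f (p z)" "H (p z, 1) = f (p z)" if "z \<in> D" for z
  proof -
    have "g z \<in> E" "q (g z) = f (p z)" using g that by (auto simp: lifting_of_def)
    moreover have "q (K (z, 0)) = H (p z, 0)" "q (K (z, 1)) = H (p z, 1)"
      using lift that by (simp_all add: lifting_of_def)
    ultimately show "H (p z, 0) = f (p z)" "H (p z, 1) = f (p z)"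
      using K0 K1 that deck_transformationD(3)[OF h] by simp_all
  qed
  then have cyclic: "homotopy_between X Y f f H" using H by (auto simp: homotopy_between_def X)
  have "g x \<in> E" using g x by (auto simp: lifting_of_def)
  note T = canonical_map_cyclic_homotopy[OF cyclic lift K0]
  have "?T (loop_class Y (curry H (p x))) = h"
    by (rule deck_transformation_eqI[OF ucY \<open>g x \<in> E\<close> T(1) h]) (use T(2) K1[OF x] in simp_all)
  then show "h \<in> ?T ` gottlieb_group X Y f (p x)"
    using cyclic x by (auto simp: gottlieb_group_eq X)
qed

theorem canonical_map_image_gottlieb_group:
  "canonical_map E q (g x) ` gottlieb_group X Y f (p x) = deck_gottlieb D p E q g"
  using canonical_map_image_gottlieb_group_subset deck_gottlieb_subset_canonical_map_image
  by (rule equalityI)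

end

lemma iso_subgroup_image:
  assumes "h \<in> iso G H" "I \<subseteq> carrier G"
  shows "h \<in> iso (G\<lparr>carrier := I\<rparr>) (H\<lparr>carrier := h ` I\<rparr>)"
  using assms by (auto simp: iso_def hom_def bij_betw_def subset_iff intro: inj_on_subset)

theorem theorem2p1:
  fixes X :: "'x::topological_space set" and Y :: "'y::topological_space set"
    and X' :: "'d::topological_space set" and Y' :: "'e::topological_space set"
    and p :: "'d \<Rightarrow> 'x" and q :: "'e \<Rightarrow> 'y"
    and K :: "'k topology" and L :: "'l topology"
    and f :: "'x \<Rightarrow> 'y" and f0 :: "'d \<Rightarrow> 'e" and x0 :: 'x and x0' :: 'd
  assumes "path_connected X" and "CW_complex K" and "top_of_set X homotopy_equivalent_space K"
    and "path_connected Y" and "CW_complex L" and "top_of_set Y homotopy_equivalent_space L"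
    and "universal_covering X' p X" and "universal_covering Y' q Y"
    and "continuous_on X f" and "f \<in> X \<rightarrow> Y"
    and "lifting_of X' p Y' q f f0"
    and "x0 \<in> X" and "x0' \<in> X'" and "p x0' = x0"
  defines "\<pi> \<equiv> fundamental_group Y (f x0)" and "\<D> \<equiv> deck_group Y' q"
    and "G \<equiv> gottlieb_group X Y f x0" and "\<D>f \<equiv> deck_gottlieb X' p Y' q f0"
    and "\<Theta> \<equiv> canonical_map Y' q (f0 x0')"
  shows "\<Theta> \<in> iso \<pi> \<D> \<and> subgroup G \<pi> \<and> subgroup \<D>f \<D> \<and>
         \<Theta> ` G = \<D>f \<and> \<Theta> \<in> iso (\<pi>\<lparr>carrier := G\<rparr>) (\<D>\<lparr>carrier := \<D>f\<rparr>)"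
proof -
  have e: "f0 x0' \<in> Y'" "q (f0 x0') = f x0"
    using assms(11,13,14) by (auto simp: lifting_of_def)
  have iso: "\<Theta> \<in> iso \<pi> \<D>"
    using canonical_map_iso[OF assms(8) e(1)] e(2) by (simp add: \<Theta>_def \<pi>_def \<D>_def)
  have image: "\<Theta> ` G = \<D>f"
    using canonical_map_image_gottlieb_group[OF assms(7,8,11,13)] assms(14)
    by (simp add: \<Theta>_def G_def \<D>f_def)
  have G: "subgroup G \<pi>"
    unfolding G_def \<pi>_def by (rule subgroup_gottlieb_group[OF assms(9,10,12)])
  have "f x0 \<in> Y" using assms(10,12) by blast
  then have "group \<pi>" "group \<D>"
    by (simp_all add: \<pi>_def \<D>_def group_fundamental_group group_deck_group)
  then have "subgroup (\<Theta> ` G) \<D>"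
    using iso G by (intro group_hom.subgroup_img_is_subgroup)
      (auto simp: group_hom_def group_hom_axioms_def iso_def)
  moreover have "\<Theta> \<in> iso (\<pi>\<lparr>carrier := G\<rparr>) (\<D>\<lparr>carrier := \<Theta> ` G\<rparr>)"
    using iso subgroup.subset[OF G] by (rule iso_subgroup_image)
  ultimately show ?thesis using iso G image by simp
qed

end
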